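(* Let $G$ be a group acting geometrically on two CAT(0) spaces $X$ and $Y$, and let $x_0\in X$ and $y_0\in Y$. Suppose that there exist constants $N>0$ and $M>0$ such that $G\,B(x_0,N)=X$, $G\,B(y_0,M)=Y$, and for all $g,a\in G$: if $[x_0,gx_0]\cap B(ax_0,N)\neq\emptyset$ in $X$, then $[y_0,gy_0]\cap B(ay_0,M)\neq\emptyset$ in $Y$. Then there exists a $G$-equivariant homeomorphism $\bar\phi:\partial X\to\partial Y$ which is a continuous extension of the quasi-isometry $\phi:Gx_0\to Gy_0$, $\phi(gx_0)=gy_0$, in the sense that for every $\alpha\in\partial X$ and every sequence $\{g_i\}_{i\in\mathbb{N}}\subset G$ such that $g_ix_0\to\alpha$ in $X\cup\partial X$, one has $g_iy_0\to\bar\phi(\alpha)$ in $Y\cup\partial Y$.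
   Context: A CAT(0) space here is a proper geodesic metric space satisfying the CAT(0) inequality. An action of a group on a CAT(0) space is geometric if it is by isometries, proper (every point $x$ has some $r>0$ such that $\{g\in G : gB(x,r)\cap B(x,r)\neq\emptyset\}$ is finite) and cocompact. $B(x,r)$ denotes the closed ball of radius $r$ about $x$, $G\,B(x,r)=\bigcup_{g\in G}gB(x,r)$, and $[p,q]$ denotes the unique geodesic segment from $p$ to $q$. The boundary $\partial X$ is the set of geodesic rays $[0,\infty)\to X$ modulo the relation of being asymptotic (one ray lies in a bounded neighborhood of the other). $X\cup\partial X$ carries the usual cone topology: $X$ is open, and for $\alpha\in\partial X$, with $\xi_\alpha$ the geodesic ray from $x_0$ to $\alpha$ and $\epsilon_0>0$ fixed, the sets $\{x\in X\cup\partial X : x\notin B(x_0,r),\ d_X(\xi_\alpha(r),\xi_x(r))<\epsilon_0\}$, $r>0$, form a neighborhood basis at $\alpha$, where $\xi_x$ is the geodesic segment or ray from $x_0$ to $x$. This is independent of the basepoint. $\partial X$ has the subspace topology, and $G$ acts on $\partial X$ by homeomorphisms via $(g\xi)(t)=g(\xi(t))$. The same conventions apply to $Y$ (with basepoint $y_0$). *)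

theory Defs
  imports "HOL-Analysis.Analysis" "HOL-Algebra.Group_Action"
begin

section \<open>CAT(0) spaces\<close>

definition geodesic_path :: "(real \<Rightarrow> 'a::metric_space) \<Rightarrow> real \<Rightarrow> 'a \<Rightarrow> 'a \<Rightarrow> bool" where
  "geodesic_path c l x y \<longleftrightarrow> 0 \<le> l \<and> c 0 = x \<and> c l = y \<and>
     (\<forall>s\<in>{0..l}. \<forall>t\<in>{0..l}. dist (c s) (c t) = \<bar>s - t\<bar>)"

definition geodesic_segment :: "'a::metric_space set \<Rightarrow> 'a \<Rightarrow> 'a \<Rightarrow> bool" where
  "geodesic_segment S x y \<longleftrightarrow> (\<exists>c l. geodesic_path c l x y \<and> S = c ` {0..l})"

text \<open>The segment \<open>[x, y]\<close>; geodesic segments are unique in a CAT(0) space.\<close>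

definition seg :: "'a::metric_space \<Rightarrow> 'a \<Rightarrow> 'a set" where
  "seg x y = (THE S. geodesic_segment S x y)"

definition comparison_point ::
  "'a::metric_space set \<Rightarrow> 'a \<Rightarrow> real^2 \<Rightarrow> real^2 \<Rightarrow> 'a \<Rightarrow> real^2 \<Rightarrow> bool" where
  "comparison_point S x x' y' u u' \<longleftrightarrow>
     u \<in> S \<and> u' \<in> closed_segment x' y' \<and> dist x' u' = dist x u"

text \<open>
  For every geodesic triangle (vertices \<open>p, q, r\<close>, sides \<open>A, B, C\<close>) and every comparison triangle
  \<open>p', q', r'\<close> in the Euclidean plane, distances between points of the triangle are at most the
  distances between their comparison points.
\<close>

definition CAT0_inequality :: "'a::metric_space itself \<Rightarrow> bool" where
  "CAT0_inequality _ \<longleftrightarrow>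
     (\<forall>(p::'a) q r A B C (p'::real^2) q' r'.
        geodesic_segment A p q \<longrightarrow> geodesic_segment B q r \<longrightarrow> geodesic_segment C r p \<longrightarrow>
        dist p' q' = dist p q \<longrightarrow> dist q' r' = dist q r \<longrightarrow> dist r' p' = dist r p \<longrightarrow>
        (let comparison = (\<lambda>u u'. comparison_point A p p' q' u u' \<or>
               comparison_point B q q' r' u u' \<or> comparison_point C r r' p' u u')
         in \<forall>u v u' v'. comparison u u' \<longrightarrow> comparison v v' \<longrightarrow> dist u v \<le> dist u' v'))"

definition CAT0_space :: "'a::metric_space itself \<Rightarrow> bool" where
  "CAT0_space T \<longleftrightarrow>
     (\<forall>(x::'a) r. compact (cball x r)) \<and>
     (\<forall>(x::'a) y. \<exists>S. geodesic_segment S x y) \<and>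
     CAT0_inequality T"


section \<open>Geometric actions\<close>

definition geometric_action ::
  "('g, 'm) monoid_scheme \<Rightarrow> ('g \<Rightarrow> 'a::metric_space \<Rightarrow> 'a) \<Rightarrow> bool" where
  "geometric_action G \<phi> \<longleftrightarrow>
     group_action G UNIV \<phi> \<and>
     (\<forall>g\<in>carrier G. \<forall>x y. dist (\<phi> g x) (\<phi> g y) = dist x y) \<and>
     (\<forall>x. \<exists>r>0. finite {g \<in> carrier G. \<phi> g ` cball x r \<inter> cball x r \<noteq> {}}) \<and>
     (\<exists>K. compact K \<and> (\<Union>g\<in>carrier G. \<phi> g ` K) = UNIV)"


section \<open>The boundary\<close>

text \<open>
  Rays are total functions whose values on negative reals are irrelevant; rays that agree on
  \<open>[0, \<infinity>)\<close> are asymptotic, so these values disappear in the quotient.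
\<close>

definition geodesic_ray :: "(real \<Rightarrow> 'a::metric_space) \<Rightarrow> bool" where
  "geodesic_ray c \<longleftrightarrow> (\<forall>s\<ge>0. \<forall>t\<ge>0. dist (c s) (c t) = \<bar>s - t\<bar>)"

definition asymptotic :: "((real \<Rightarrow> 'a::metric_space) \<times> (real \<Rightarrow> 'a)) set" where
  "asymptotic = {(c, c'). geodesic_ray c \<and> geodesic_ray c' \<and>
     (\<exists>K. \<forall>t\<ge>0. \<exists>s\<ge>0. dist (c t) (c' s) \<le> K)}"

definition boundary :: "(real \<Rightarrow> 'a::metric_space) set set" where
  "boundary = {c. geodesic_ray c} // asymptotic"

text \<open>
  The map of the boundary induced by a bijective isometry \<open>f\<close>: the image of the class of \<open>c\<close>
  is exactly the class of \<open>f \<circ> c\<close>.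
\<close>

definition boundary_map ::
  "('a::metric_space \<Rightarrow> 'a) \<Rightarrow> (real \<Rightarrow> 'a) set \<Rightarrow> (real \<Rightarrow> 'a) set" where
  "boundary_map f \<alpha> = (\<lambda>c. f \<circ> c) ` \<alpha>"


section \<open>The cone topology\<close>

text \<open>\<open>X \<union> \<partial>X\<close> as a disjoint union.\<close>

type_synonym 'a bordif = "'a + (real \<Rightarrow> 'a) set"

definition bordification :: "'a::metric_space bordif set" where
  "bordification = range Inl \<union> Inr ` boundary"

text \<open>
  \<open>geodesic_to x\<^sub>0 x c\<close>: \<open>c\<close> is the geodesic segment or ray from \<open>x\<^sub>0\<close> to \<open>x\<close>. In a CAT(0) space it
  exists and is unique on its domain \<open>[0, d(x\<^sub>0, x)]\<close> or \<open>[0, \<infinity>)\<close>, so in \<open>cone_nbhd\<close> below the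
  quantified \<open>c\<close> and \<open>c'\<close>, which are evaluated inside these domains only, denote
  \<open>\<xi>\<^sub>\<alpha>\<close> and \<open>\<xi>\<^sub>x\<close>.
\<close>

definition geodesic_to ::
  "'a::metric_space \<Rightarrow> 'a bordif \<Rightarrow> (real \<Rightarrow> 'a) \<Rightarrow> bool" where
  "geodesic_to x\<^sub>0 x c = (case x of
       Inl p \<Rightarrow> geodesic_path c (dist x\<^sub>0 p) x\<^sub>0 p
     | Inr \<alpha> \<Rightarrow> c \<in> \<alpha> \<and> c 0 = x\<^sub>0)"

definition cone_nbhd ::
  "'a::metric_space \<Rightarrow> real \<Rightarrow> (real \<Rightarrow> 'a) set \<Rightarrow> real \<Rightarrow> 'a bordif set" where
  "cone_nbhd x\<^sub>0 \<epsilon> \<alpha> r = {x \<in> bordification. x \<notin> Inl ` cball x\<^sub>0 r \<and>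
     (\<exists>c c'. geodesic_to x\<^sub>0 (Inr \<alpha>) c \<and> geodesic_to x\<^sub>0 x c' \<and> dist (c r) (c' r) < \<epsilon>)}"

text \<open>
  The topology for which \<open>X\<close> is open with its metric topology and the sets \<open>cone_nbhd x\<^sub>0 \<epsilon> \<alpha> r\<close>
  with \<open>r > 0\<close> (which need not be open) form a neighbourhood basis at \<open>\<alpha>\<close>.
\<close>

definition cone_open :: "'a::metric_space \<Rightarrow> real \<Rightarrow> 'a bordif set \<Rightarrow> bool" where
  "cone_open x\<^sub>0 \<epsilon> U \<longleftrightarrow> U \<subseteq> bordification \<and> open (Inl -` U) \<and>
     (\<forall>\<alpha>\<in>boundary. Inr \<alpha> \<in> U \<longrightarrow> (\<exists>r>0. cone_nbhd x\<^sub>0 \<epsilon> \<alpha> r \<subseteq> U))"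

definition cone_topology :: "'a::metric_space \<Rightarrow> real \<Rightarrow> 'a bordif topology" where
  "cone_topology x\<^sub>0 \<epsilon> = topology (cone_open x\<^sub>0 \<epsilon>)"

definition boundary_topology :: "'a::metric_space \<Rightarrow> real \<Rightarrow> (real \<Rightarrow> 'a) set topology" where
  "boundary_topology x\<^sub>0 \<epsilon> = pullback_topology boundary Inr (cone_topology x\<^sub>0 \<epsilon>)"


section \<open>The cone topology is well defined\<close>

text \<open>
  The \<open>cone_open\<close> sets are closed under intersection because \<open>cone_nbhd x\<^sub>0 \<epsilon> \<alpha> r\<close> decreases with
  \<open>r\<close>, which rests on the CAT(0) inequality.
\<close>

lemma comparison_isosceles:
  fixes R D :: real
  assumes "0 < R" "0 \<le> D" "D \<le> 2 * R"
  shows "\<exists>q r::real^2. norm q = R \<and> norm r = R \<and> dist q r = D"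
proof -
  define k where "k = 1 - D\<^sup>2 / (2 * R\<^sup>2)"
  have "D\<^sup>2 \<le> (2 * R)\<^sup>2" using assms by (intro power_mono) auto
  then have k: "-1 \<le> k" "k \<le> 1"
    using assms by (auto simp: k_def field_simps power2_eq_square)
  define h where "h = sqrt (1 - k\<^sup>2)"
  have "k\<^sup>2 \<le> 1" using k by (simp add: abs_square_le_1 abs_le_iff)
  then have h: "h\<^sup>2 = 1 - k\<^sup>2" by (simp add: h_def)
  define q :: "real^2" where "q = vector [R, 0]"
  define r :: "real^2" where "r = vector [R * k, R * h]"
  have "norm q = R" using assms by (simp add: q_def norm_vec_def L2_set_def sum_2)
  moreover have "norm r = R"
  proof -
    have "(R * k)\<^sup>2 + (R * h)\<^sup>2 = R\<^sup>2" by (simp add: power_mult_distrib h algebra_simps)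
    then show ?thesis using assms by (simp add: r_def norm_vec_def L2_set_def sum_2)
  qed
  moreover have "dist q r = D"
  proof -
    have "(R - R * k)\<^sup>2 + (R * h)\<^sup>2 = 2 * R\<^sup>2 * (1 - k)"
      by (simp add: power_mult_distrib h power2_diff algebra_simps) (simp add: power2_eq_square)
    also have "\<dots> = D\<^sup>2" using assms by (simp add: k_def field_simps)
    finally show ?thesis
      using assms by (simp add: q_def r_def dist_norm norm_vec_def L2_set_def sum_2)
  qed
  ultimately show ?thesis by blast
qed

lemma geodesic_path_restrict:
  assumes "geodesic_path c l x y" "0 \<le> R" "R \<le> l"
  shows "geodesic_path c R x (c R)"
  using assms unfolding geodesic_path_def by auto

lemma geodesic_segment_commute:
  assumes "geodesic_segment S x y"
  shows "geodesic_segment S y x"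
proof -
  obtain c l where c: "geodesic_path c l x y" "S = c ` {0..l}"
    using assms unfolding geodesic_segment_def by blast
  have "geodesic_path (\<lambda>t. c (l - t)) l y x"
    using c unfolding geodesic_path_def by auto
  moreover have "(\<lambda>t. c (l - t)) ` {0..l} = c ` {0..l}"
  proof -
    have "(\<lambda>t. c (l - t)) ` {0..l} = c ` ((\<lambda>t. l - t) ` {0..l})"
      by (simp only: image_image)
    then show ?thesis by (simp only: image_diff_atLeastAtMost diff_self diff_zero)
  qed
  ultimately show ?thesis unfolding geodesic_segment_def using c by metis
qed

lemma geodesics_diverge:
  fixes c c' :: "real \<Rightarrow> 'a::metric_space"
  assumes X: "CAT0_space TYPE('a)"
    and c: "geodesic_path c R x y" and c': "geodesic_path c' R x z"
    and r: "0 < r" "r \<le> R"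
  shows "dist (c r) (c' r) \<le> dist y z"
proof -
  have R: "0 < R" using r by simp
  have xy: "dist x y = R" "dist x z = R"
  proof -
    have "0 \<in> {0..R}" "R \<in> {0..R}" using R by auto
    then have "dist (c 0) (c R) = \<bar>0 - R\<bar>" "dist (c' 0) (c' R) = \<bar>0 - R\<bar>"
      using c c' unfolding geodesic_path_def by blast+
    then show "dist x y = R" "dist x z = R"
      using c c' R unfolding geodesic_path_def by auto
  qed
  have "dist y z \<le> 2 * R" using dist_triangle3[of y z x] xy by simp
  then obtain q s :: "real^2" where qs: "norm q = R" "norm s = R" "dist q s = dist y z"
    using comparison_isosceles[OF R] by (metis zero_le_dist)
  obtain B where B: "geodesic_segment B y z"
    using X unfolding CAT0_space_def by blast
  have A: "geodesic_segment (c ` {0..R}) x y" and C': "geodesic_segment (c' ` {0..R}) x z"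
    using c c' unfolding geodesic_segment_def by blast+
  note C = geodesic_segment_commute[OF C']
  define u v where "u = (r / R) *\<^sub>R q" and "v = (r / R) *\<^sub>R s"
  have t: "0 \<le> r / R" "r / R \<le> 1" using r R by auto
  have cr: "dist x (c r) = r" "dist z (c' r) = R - r"
  proof -
    have "r \<in> {0..R}" "0 \<in> {0..R}" "R \<in> {0..R}" using r R by auto
    then have "dist (c 0) (c r) = \<bar>0 - r\<bar>" "dist (c' R) (c' r) = \<bar>R - r\<bar>"
      using c c' unfolding geodesic_path_def by blast+
    then show "dist x (c r) = r" "dist z (c' r) = R - r"
      using c c' r unfolding geodesic_path_def by auto
  qed
  have "dist 0 u = r" using r R qs by (simp add: u_def)
  moreover have "u \<in> closed_segment 0 q"
    using t by (auto simp: u_def in_segment)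
  ultimately have cu: "comparison_point (c ` {0..R}) x 0 q (c r) u"
    using r cr by (auto simp: comparison_point_def)
  have "s - v = (1 - r / R) *\<^sub>R s" by (simp add: v_def scaleR_left_diff_distrib)
  then have "dist s v = (1 - r / R) * R" using qs t by (simp add: dist_norm)
  also have "\<dots> = R - r" using R by (simp add: field_simps)
  finally have "dist s v = R - r" .
  moreover have "v \<in> closed_segment s 0"
    using t by (subst closed_segment_commute) (auto simp: v_def in_segment)
  ultimately have cv: "comparison_point (c' ` {0..R}) z s 0 (c' r) v"
    using r cr by (auto simp: comparison_point_def)
  have tri: "dist 0 q = dist x y" "dist q s = dist y z" "dist s 0 = dist z x"
    using qs xy by (simp_all add: dist_commute)
  have "CAT0_inequality TYPE('a)" using X unfolding CAT0_space_def by blast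
  then have "dist (c r) (c' r) \<le> dist u v"
    unfolding CAT0_inequality_def Let_def
    using A B C tri cu cv by blast
  also have "dist u v = (r / R) * dist q s"
  proof -
    have "u - v = (r / R) *\<^sub>R (q - s)" by (simp add: u_def v_def scaleR_diff_right)
    then show ?thesis unfolding dist_norm using t by (simp only: norm_scaleR abs_of_nonneg)
  qed
  also have "\<dots> \<le> 1 * dist q s" using t by (intro mult_right_mono) auto
  finally show ?thesis using qs by simp
qed

lemma geodesic_to_path:
  assumes "geodesic_to x\<^sub>0 x c" "x \<in> bordification" "x \<notin> Inl ` cball x\<^sub>0 R" "0 \<le> R"
  shows "geodesic_path c R x\<^sub>0 (c R)"
proof (cases x)
  case (Inl p)
  then have "R \<le> dist x\<^sub>0 p" using assms by (auto simp: mem_cball)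
  then show ?thesis
    using Inl assms geodesic_path_restrict by (fastforce simp: geodesic_to_def)
next
  case (Inr \<alpha>)
  then have "\<alpha> \<in> boundary" "c \<in> \<alpha>" "c 0 = x\<^sub>0"
    using assms by (auto simp: bordification_def geodesic_to_def)
  then have "geodesic_ray c"
    by (auto simp: boundary_def quotient_def asymptotic_def)
  then show ?thesis
    using assms \<open>c 0 = x\<^sub>0\<close> by (auto simp: geodesic_path_def geodesic_ray_def)
qed

lemma cone_nbhd_antimono:
  fixes x\<^sub>0 :: "'a::metric_space"
  assumes X: "CAT0_space TYPE('a)" and \<alpha>: "\<alpha> \<in> boundary" and r: "0 < r" "r \<le> R"
  shows "cone_nbhd x\<^sub>0 \<epsilon> \<alpha> R \<subseteq> cone_nbhd x\<^sub>0 \<epsilon> \<alpha> r"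
proof
  fix x assume "x \<in> cone_nbhd x\<^sub>0 \<epsilon> \<alpha> R"
  then obtain c c' where x: "x \<in> bordification" "x \<notin> Inl ` cball x\<^sub>0 R"
    and c: "geodesic_to x\<^sub>0 (Inr \<alpha>) c" and c': "geodesic_to x\<^sub>0 x c'"
    and d: "dist (c R) (c' R) < \<epsilon>"
    unfolding cone_nbhd_def by blast
  have "Inr \<alpha> \<in> bordification" "Inr \<alpha> \<notin> Inl ` cball x\<^sub>0 R"
    using \<alpha> by (auto simp: bordification_def)
  then have "geodesic_path c R x\<^sub>0 (c R)" "geodesic_path c' R x\<^sub>0 (c' R)"
    using geodesic_to_path c c' x r by (smt (verit))+
  then have "dist (c r) (c' r) < \<epsilon>"
    using geodesics_diverge[OF X] r d by (smt (verit))
  moreover have "x \<notin> Inl ` cball x\<^sub>0 r" using x r by (auto simp: mem_cball)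
  ultimately show "x \<in> cone_nbhd x\<^sub>0 \<epsilon> \<alpha> r"
    unfolding cone_nbhd_def using x c c' by blast
qed

lemma istopology_cone_open:
  fixes x\<^sub>0 :: "'a::metric_space"
  assumes X: "CAT0_space TYPE('a)"
  shows "istopology (cone_open x\<^sub>0 \<epsilon>)"
  unfolding istopology_def
proof (intro conjI allI impI)
  fix S T assume S: "cone_open x\<^sub>0 \<epsilon> S" and T: "cone_open x\<^sub>0 \<epsilon> T"
  have "\<exists>r>0. cone_nbhd x\<^sub>0 \<epsilon> \<alpha> r \<subseteq> S \<inter> T"
    if \<alpha>: "\<alpha> \<in> boundary" "Inr \<alpha> \<in> S \<inter> T" for \<alpha>
  proof -
    obtain r s where "r > 0" "s > 0" "cone_nbhd x\<^sub>0 \<epsilon> \<alpha> r \<subseteq> S" "cone_nbhd x\<^sub>0 \<epsilon> \<alpha> s \<subseteq> T"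
      using S T \<alpha> unfolding cone_open_def by (meson IntD1 IntD2)
    then have "max r s > 0" "cone_nbhd x\<^sub>0 \<epsilon> \<alpha> (max r s) \<subseteq> S \<inter> T"
      using cone_nbhd_antimono[OF X \<alpha>(1), of r "max r s" x\<^sub>0 \<epsilon>]
        cone_nbhd_antimono[OF X \<alpha>(1), of s "max r s" x\<^sub>0 \<epsilon>] by auto
    then show ?thesis by blast
  qed
  moreover have "open (Inl -` (S \<inter> T) :: 'a set)"
    using S T by (auto simp: cone_open_def vimage_Int)
  ultimately show "cone_open x\<^sub>0 \<epsilon> (S \<inter> T)"
    using S unfolding cone_open_def by blast
next
  fix \<K> assume K: "\<forall>U\<in>\<K>. cone_open x\<^sub>0 \<epsilon> U"
  then have "open (Inl -` \<Union>\<K> :: 'a set)"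
    by (auto simp: cone_open_def vimage_Union)
  with K show "cone_open x\<^sub>0 \<epsilon> (\<Union>\<K>)"
    unfolding cone_open_def by (meson Sup_least Union_iff Union_upper subset_trans)
qed

lemma openin_cone_topology:
  fixes x\<^sub>0 :: "'a::metric_space"
  assumes "CAT0_space TYPE('a)"
  shows "openin (cone_topology x\<^sub>0 \<epsilon>) = cone_open x\<^sub>0 \<epsilon>"
  using istopology_cone_open[OF assms] by (simp add: cone_topology_def topology_inverse')

lemma topspace_cone_topology:
  fixes x\<^sub>0 :: "'a::metric_space"
  assumes "CAT0_space TYPE('a)"
  shows "topspace (cone_topology x\<^sub>0 \<epsilon>) = bordification"
proof -
  have "Inl -` bordification = (UNIV :: 'a set)" by (auto simp: bordification_def)
  moreover have "cone_nbhd x\<^sub>0 \<epsilon> \<alpha> 1 \<subseteq> bordification" for \<alpha> by (auto simp: cone_nbhd_def)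
  ultimately have "cone_open x\<^sub>0 \<epsilon> bordification"
    unfolding cone_open_def by (metis order_refl open_UNIV zero_less_one)
  then show ?thesis
    using openin_cone_topology[OF assms, of x\<^sub>0 \<epsilon>]
    by (metis cone_open_def openin_subset openin_topspace subset_antisym)
qed

lemma topspace_boundary_topology:
  fixes x\<^sub>0 :: "'a::metric_space"
  assumes "CAT0_space TYPE('a)"
  shows "topspace (boundary_topology x\<^sub>0 \<epsilon>) = boundary"
  by (auto simp: boundary_topology_def topspace_pullback_topology
      topspace_cone_topology[OF assms] bordification_def)

end

theory Submission
  imports Defs
begin

text \<open>
  Properness and cocompactness make \<open>g x\<^sub>0 \<mapsto> g y\<^sub>0\<close> a coarse equivalence of orbits. Let a ray \<open>\<xi>\<close>
  from \<open>x\<^sub>0\<close> and a ray \<open>\<eta>\<close> from \<open>y\<^sub>0\<close> correspond if they run, up to a uniform error, along the same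
  group elements. CAT(0) geodesics from one point that come within bounded distance of each other
  far out are uniformly close near their origin; hence corresponding rays determine each other, and
  continuously so in both directions. If \<open>g\<^sub>n x\<^sub>0\<close> stays close to \<open>\<xi> n\<close>, the hypothesis forces
  the segments \<open>[y\<^sub>0, g\<^sub>n y\<^sub>0]\<close> to pass near \<open>a y\<^sub>0\<close> for every \<open>a x\<^sub>0\<close> near \<open>\<xi>\<close>, so that a limit of
  these segments corresponds to \<open>\<xi>\<close>. Conversely, if \<open>h\<^sub>n y\<^sub>0\<close> stays close to \<open>\<eta> n\<close>, then \<open>\<eta>\<close>
  corresponds to any limit of the segments \<open>[x\<^sub>0, h\<^sub>n x\<^sub>0]\<close>. Thus the one-sided hypothesis already
  yields a bijection of the boundaries.
\<close>

section \<open>Geodesics in CAT(0) spaces\<close>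

text \<open>A coarse equivalence of orbits does not in general induce a map of boundaries: unlike in
  hyperbolic spaces, a quasi-isometry need not carry geodesics near geodesics, and Croke and Kleiner
  found a group acting geometrically on two CAT(0) spaces with non-homeomorphic boundaries. The
  segment hypothesis replaces the missing stability of quasi-geodesics, but it transfers nearness
  from X to Y only. The way back uses no reversed hypothesis: a limit ray in X is carried forward
  again, and its image must be the ray one started with, because the same segments in Y follow both.
  Two uniformities carry the topology. The bound in \<open>shadows\<close> is one number for all
  rays, so a single radius serves all corresponding pairs. And geodesics with a common origin
  contract linearly towards it, so a discrepancy of any fixed size far out becomes as small as
  desired near the origin; this is how a cone topology with one fixed \<open>\<epsilon>\<close> is
  handled.\<close>

lemma geodesic_path_dist:
  assumes "geodesic_path c l x y" "0 \<le> t" "t \<le> l"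
  shows "dist x (c t) = t"
proof -
  have "dist (c 0) (c t) = \<bar>0 - t\<bar>"
    using assms unfolding geodesic_path_def by (meson atLeastAtMost_iff order_refl order_trans)
  then show ?thesis using assms unfolding geodesic_path_def by auto
qed

lemma geodesic_path_length:
  assumes "geodesic_path c l x y"
  shows "l = dist x y"
  using geodesic_path_dist[OF assms, of l] assms unfolding geodesic_path_def by auto

lemma geodesic_path_dist2:
  assumes "geodesic_path c l x y" "0 \<le> s" "s \<le> l" "0 \<le> t" "t \<le> l"
  shows "dist (c s) (c t) = \<bar>s - t\<bar>"
  using assms unfolding geodesic_path_def by auto

lemma geodesic_path_exists:
  assumes "CAT0_space TYPE('a::metric_space)"
  obtains c where "geodesic_path c (dist x y) x (y::'a)"
  using assms geodesic_path_length unfolding CAT0_space_def geodesic_segment_def by metis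

lemma geodesic_paths_exist:
  assumes X: "CAT0_space TYPE('a::metric_space)"
  obtains c where "\<And>i. geodesic_path (c i) (dist x (y i)) x (y i :: 'a)"
proof -
  have "\<forall>i. \<exists>c. geodesic_path c (dist x (y i)) x (y i)"
    using geodesic_path_exists[OF X] by metis
  then show thesis using that by metis
qed

lemma geodesic_path_reverse:
  assumes "geodesic_path c l x y"
  shows "geodesic_path (\<lambda>t. c (l - t)) l y x"
  using assms unfolding geodesic_path_def by auto

text \<open>Comparison with an isosceles Euclidean triangle, as for
  \<open>geodesics_diverge\<close>, but keeping the factor \<open>r / R\<close>. This factor turns a
  bounded distance far out into a small one near the origin.\<close>

lemma geodesics_contract:
  fixes c c' :: "real \<Rightarrow> 'a::metric_space"
  assumes X: "CAT0_space TYPE('a)"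
    and c: "geodesic_path c R x y" and c': "geodesic_path c' R x z"
    and r: "0 \<le> r" "r \<le> R" "0 < R"
  shows "dist (c r) (c' r) \<le> r / R * dist y z"
proof -
  have xy: "dist x y = R" "dist x z = R"
    using geodesic_path_length c c' by metis+
  have "dist y z \<le> 2 * R" using dist_triangle3[of y z x] xy by simp
  then obtain q s :: "real^2" where qs: "norm q = R" "norm s = R" "dist q s = dist y z"
    using comparison_isosceles[OF r(3)] by (metis zero_le_dist)
  obtain B where B: "geodesic_segment B y z"
    using X unfolding CAT0_space_def by blast
  have A: "geodesic_segment (c ` {0..R}) x y" and C: "geodesic_segment (c' ` {0..R}) z x"
    using c c' geodesic_segment_commute unfolding geodesic_segment_def by blast+
  define u v where "u = (r / R) *\<^sub>R q" and "v = (r / R) *\<^sub>R s"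
  have t: "0 \<le> r / R" "r / R \<le> 1" using r by auto
  have "u \<in> closed_segment 0 q"
    using t by (auto simp: u_def in_segment)
  then have cu: "comparison_point (c ` {0..R}) x 0 q (c r) u"
    using r qs geodesic_path_dist[OF c] by (auto simp: comparison_point_def u_def)
  have "s - v = (1 - r / R) *\<^sub>R s" by (simp add: v_def scaleR_left_diff_distrib)
  then have "dist s v = (1 - r / R) * R" using qs t by (simp add: dist_norm)
  also have "\<dots> = R - r" using r by (simp add: field_simps)
  also have "\<dots> = dist z (c' r)"
    using geodesic_path_dist2[OF c', of R r] c' r by (simp add: geodesic_path_def)
  finally have "dist s v = dist z (c' r)" .
  moreover have "v \<in> closed_segment s 0"
    using t by (subst closed_segment_commute) (auto simp: v_def in_segment)
  ultimately have cv: "comparison_point (c' ` {0..R}) z s 0 (c' r) v"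
    using r by (auto simp: comparison_point_def)
  have tri: "dist 0 q = dist x y" "dist q s = dist y z" "dist s 0 = dist z x"
    using qs xy by (simp_all add: dist_commute)
  have "CAT0_inequality TYPE('a)" using X unfolding CAT0_space_def by blast
  then have "dist (c r) (c' r) \<le> dist u v"
    unfolding CAT0_inequality_def Let_def using A B C tri cu cv by blast
  also have "dist u v = (r / R) * dist q s"
  proof -
    have "u - v = (r / R) *\<^sub>R (q - s)" by (simp add: u_def v_def scaleR_diff_right)
    then show ?thesis unfolding dist_norm using t by (simp only: norm_scaleR abs_of_nonneg)
  qed
  finally show ?thesis using qs by simp
qed

lemma geodesics_diverge_le:
  fixes c c' :: "real \<Rightarrow> 'a::metric_space"
  assumes X: "CAT0_space TYPE('a)"
    and c: "geodesic_path c l x y" and c': "geodesic_path c' l' x z"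
    and r: "0 \<le> r" "r \<le> R" "R \<le> l" "R \<le> l'"
  shows "dist (c r) (c' r) \<le> dist (c R) (c' R)"
proof (cases "r = 0")
  case True
  then show ?thesis using c c' unfolding geodesic_path_def by auto
next
  case False
  have "geodesic_path c R x (c R)" "geodesic_path c' R x (c' R)"
    using geodesic_path_restrict c c' r by (smt (verit))+
  then show ?thesis using geodesics_diverge[OF X] r False by (smt (verit))
qed

lemma geodesic_path_unique:
  fixes c c' :: "real \<Rightarrow> 'a::metric_space"
  assumes X: "CAT0_space TYPE('a)"
    and c: "geodesic_path c l x y" and c': "geodesic_path c' l' x y"
    and r: "0 \<le> r" "r \<le> l"
  shows "c r = c' r"
proof -
  have "l' = l" using geodesic_path_length c c' by metis
  then have "dist (c r) (c' r) \<le> dist (c l) (c' l)"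
    using geodesics_diverge_le[OF X c c'] r by auto
  then show ?thesis using c c' \<open>l' = l\<close> by (auto simp: geodesic_path_def)
qed

lemma seg_eq_image:
  fixes c :: "real \<Rightarrow> 'a::metric_space"
  assumes X: "CAT0_space TYPE('a)" and c: "geodesic_path c l x y"
  shows "seg x y = c ` {0..l}"
  unfolding seg_def
proof (rule the_equality)
  show "geodesic_segment (c ` {0..l}) x y"
    using c unfolding geodesic_segment_def by blast
next
  fix S assume "geodesic_segment S x y"
  then obtain c' l' where c': "geodesic_path c' l' x y" "S = c' ` {0..l'}"
    unfolding geodesic_segment_def by blast
  have "l' = l" using geodesic_path_length c c' by metis
  then show "S = c ` {0..l}"
    using c'(2) geodesic_path_unique[OF X c c'(1)] by (auto intro!: image_cong)
qed

text \<open>Nearby points of two geodesics from \<open>x\<close> have parameters differing by at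
  most \<open>K\<close>, so they can be replaced by points at equal parameter, at the price of
  doubling \<open>K\<close>. The bounds mention \<open>s\<close> only, so nothing has to be known
  about \<open>s'\<close> beforehand.\<close>

lemma geodesics_close_initial:
  fixes c c' :: "real \<Rightarrow> 'a::metric_space"
  assumes X: "CAT0_space TYPE('a)"
    and c: "geodesic_path c l x y" and c': "geodesic_path c' l' x y'"
    and s: "0 \<le> s" "s \<le> l" and s': "0 \<le> s'" "s' \<le> l'"
    and K: "dist (c s) (c' s') \<le> K" and r: "0 \<le> r" "r \<le> s - K" "0 < s - K"
  shows "r \<le> s'" and "dist (c r) (c' r) \<le> r / (s - K) * (2 * K)"
    and "dist (c r) (c' r) \<le> 2 * K"
proof -
  have "dist x (c s) = s" "dist x (c' s') = s'"
    using geodesic_path_dist c c' s s' by metis+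
  then have ss: "\<bar>s - s'\<bar> \<le> K"
    using K dist_triangle[of x "c s" "c' s'"] dist_triangle[of x "c' s'" "c s"]
    by (auto simp: dist_commute)
  then show "r \<le> s'" using r by simp
  \<comment> \<open>One of the two points already sits at parameter \<open>m\<close>; the other
    moves by at most \<open>K\<close>.\<close>
  define m where "m = min s s'"
  have m: "s - K \<le> m" "0 < m" "m \<le> l" "m \<le> l'" "r \<le> m"
    using ss r s s' by (auto simp: m_def)
  have K0: "0 \<le> K" using ss by linarith
  have "dist (c m) (c s) = \<bar>m - s\<bar>" "dist (c' m) (c' s') = \<bar>m - s'\<bar>"
    using geodesic_path_dist2 c c' s s' m by (metis less_imp_le)+
  then have "dist (c m) (c' m) \<le> \<bar>m - s\<bar> + K + \<bar>m - s'\<bar>"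
    using K dist_triangle[of "c m" "c' m" "c s"] dist_triangle[of "c s" "c' m" "c' s'"]
      dist_commute[of "c' s'" "c' m"] by linarith
  also have "\<dots> \<le> 2 * K" using ss by (auto simp: m_def)
  finally have d: "dist (c m) (c' m) \<le> 2 * K" .
  have "dist (c r) (c' r) \<le> r / m * dist (c m) (c' m)"
    using geodesics_contract[OF X, of c m x "c m" c' "c' m" r]
      geodesic_path_restrict[OF c, of m] geodesic_path_restrict[OF c', of m] m r by auto
  also have "\<dots> \<le> r / (s - K) * (2 * K)"
    using d m r by (intro mult_mono divide_left_mono) auto
  finally show R: "dist (c r) (c' r) \<le> r / (s - K) * (2 * K)" .
  have "r / (s - K) * (2 * K) \<le> 1 * (2 * K)"
    using r K0 by (intro mult_right_mono) auto
  with R show "dist (c r) (c' r) \<le> 2 * K" by simp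
qed

text \<open>The threshold \<open>S\<close> is chosen before the geodesics; this uniformity is the
  source of all later radii.\<close>

lemma geodesics_close_eventually:
  assumes X: "CAT0_space TYPE('a::metric_space)" and r: "0 \<le> r" and K: "0 \<le> K" and e: "0 < e"
  obtains S where "\<And>c c' :: real \<Rightarrow> 'a. \<And>l l' x y y' s s'.
     \<lbrakk>geodesic_path c l x y; geodesic_path c' l' x y'; 0 \<le> s; s \<le> l; 0 \<le> s'; s' \<le> l';
      dist (c s) (c' s') \<le> K; S \<le> s\<rbrakk> \<Longrightarrow> r < l \<and> r < l' \<and> dist (c r) (c' r) < e"
proof
  fix c c' :: "real \<Rightarrow> 'a" and l l' x y y' s s'
  assume c: "geodesic_path c l x y" and c': "geodesic_path c' l' x y'"
    and s: "0 \<le> s" "s \<le> l" and s': "0 \<le> s'" "s' \<le> l'" and d: "dist (c s) (c' s') \<le> K"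
    \<comment> \<open>This threshold is the witness for \<open>S\<close>: the last summand pushes
      the contracted bound \<open>r / (s - K) * (2 * K)\<close> below \<open>e\<close>, and
      \<open>r + 1\<close> keeps parameter \<open>r\<close> strictly inside both geodesics.\<close>
    and S: "K + (r + 1) + r * (2 * K) / e \<le> s"
  have *: "0 \<le> r * (2 * K) / e" using r K e by simp
  have sK: "r * (2 * K) / e < s - K" "r + 1 \<le> s - K" "0 < s - K" using S r * by linarith+
  have "r + 1 \<le> s'"
    using geodesics_close_initial(1)[OF X c c' s s' d _ sK(2,3)] r by simp
  then have "r < l" "r < l'" using sK K s s' by linarith+
  moreover have "dist (c r) (c' r) \<le> r / (s - K) * (2 * K)"
    using geodesics_close_initial(2)[OF X c c' s s' d, of r] sK r by simp
  moreover have "r / (s - K) * (2 * K) < e"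
    using sK(1,3) e by (simp add: field_simps)
  ultimately show "r < l \<and> r < l' \<and> dist (c r) (c' r) < e" by simp
qed

section \<open>Rays and limits of segments\<close>

lemma geodesic_ray_path:
  assumes "geodesic_ray c" "0 \<le> l"
  shows "geodesic_path c l (c 0) (c l)"
  using assms by (auto simp: geodesic_ray_def geodesic_path_def)

lemma geodesic_ray_dist:
  assumes "geodesic_ray c" "0 \<le> t"
  shows "dist (c 0) (c t) = t"
  using assms by (auto simp: geodesic_ray_def)

lemma filterlim_ge_shift:
  fixes l :: "nat \<Rightarrow> real"
  assumes "\<And>n. real n - C \<le> l n"
  shows "filterlim l at_top sequentially"
proof (rule filterlim_at_top_mono)
  show "filterlim (\<lambda>n. - C + real n) at_top sequentially"
    using filterlim_tendsto_add_at_top[OF tendsto_const filterlim_real_sequentially] .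
  show "\<forall>\<^sub>F n in sequentially. - C + real n \<le> l n"
    using assms by (intro always_eventually allI) (simp add: algebra_simps)
qed

text \<open>Tychonoff's theorem replaces a diagonal subsequence: \<open>b\<close> is a cluster point
  of the segments in a product of compact balls. Approximation at one parameter \<open>R\<close> at
  a time suffices for later use, since closeness at \<open>R\<close> propagates to all smaller
  parameters.\<close>

lemma limit_ray:
  fixes c :: "nat \<Rightarrow> real \<Rightarrow> 'a::metric_space"
  assumes proper: "\<And>(x::'a) r. compact (cball x r)"
    and c: "\<And>n. geodesic_path (c n) (l n) x (y n)"
    and l: "filterlim l at_top sequentially"
  obtains b where "geodesic_ray b" "b 0 = x"
    and "\<And>R e n0. \<lbrakk>0 \<le> R; 0 < e\<rbrakk> \<Longrightarrow> \<exists>n\<ge>n0. R \<le> l n \<and> dist (c n R) (b R) < e"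
proof -
  have l0: "0 \<le> l n" for n using c[of n] by (simp add: geodesic_path_def)
  \<comment> \<open>Freezing each segment at its two ends makes it total and keeps its value at
    \<open>t\<close> within \<bar>t\<bar> of \<open>x\<close>, hence inside the compact product
    \<open>P\<close>.\<close>
  define f where "f = (\<lambda>n t. c n (max 0 (min t (l n))))"
  define P where "P = Pi UNIV (\<lambda>t. cball x \<bar>t\<bar>)"
  have "f n t \<in> cball x \<bar>t\<bar>" for n t
    using geodesic_path_dist[OF c[of n], of "max 0 (min t (l n))"] l0[of n]
    by (simp add: f_def mem_cball)
  then have fP: "f n \<in> P" for n by (simp add: P_def)
  have "compactin (product_topology (\<lambda>_. euclidean) UNIV) (PiE UNIV (\<lambda>t. cball x \<bar>t\<bar>))"
    by (simp add: compactin_PiE proper)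
  then have "compact P"
    unfolding P_def PiE_UNIV_domain by (simp add: euclidean_product_topology)
  moreover have "filtermap f sequentially \<noteq> bot" by (simp add: filtermap_bot_iff)
  moreover have "eventually (\<lambda>h. h \<in> P) (filtermap f sequentially)"
    using fP by (simp add: eventually_filtermap)
  ultimately obtain b where b: "inf (nhds b) (filtermap f sequentially) \<noteq> bot"
    unfolding compact_filter by meson
  \<comment> \<open>Basic neighborhoods in the product topology control finitely many parameters at
    once. Pairs \<open>{s, t}\<close> are what the geodesic property of \<open>b\<close>
    requires.\<close>
  have cluster: "\<exists>n\<ge>n0. \<forall>t\<in>T. t \<le> l n \<and> dist (c n t) (b t) < e"
    if T: "finite T" "\<And>t. t \<in> T \<Longrightarrow> 0 \<le> t" and e: "0 < e" for T e n0
  proof -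
    have "open {h :: real \<Rightarrow> 'a. dist (h t) (b t) < e}" for t
    proof -
      have "{h :: real \<Rightarrow> 'a. dist (h t) (b t) < e} = (\<lambda>h. h t) -` ball (b t) e"
        by (auto simp: dist_commute)
      then show ?thesis by (simp add: open_vimage)
    qed
    then have "eventually (\<lambda>h. dist (h t) (b t) < e) (nhds b)" for t
      using eventually_nhds_in_open[of "{h. dist (h t) (b t) < e}" b] e by simp
    then have 1: "eventually (\<lambda>h. \<forall>t\<in>T. dist (h t) (b t) < e) (nhds b)"
      using T by (simp add: eventually_ball_finite)
    have "eventually (\<lambda>n. n0 \<le> n \<and> (\<forall>t\<in>T. t \<le> l n)) sequentially"
      using l unfolding filterlim_at_top
      by (intro eventually_conj eventually_ge_at_top eventually_ball_finite T(1)) blast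
    then have 2: "eventually (\<lambda>h. \<exists>n. h = f n \<and> n0 \<le> n \<and> (\<forall>t\<in>T. t \<le> l n))
        (filtermap f sequentially)"
      unfolding eventually_filtermap by (rule eventually_mono) blast
    have "\<exists>h. (\<forall>t\<in>T. dist (h t) (b t) < e) \<and> (\<exists>n. h = f n \<and> n0 \<le> n \<and> (\<forall>t\<in>T. t \<le> l n))"
    proof (rule ccontr)
      assume "\<not> ?thesis"
      then have "eventually (\<lambda>_. False) (inf (nhds b) (filtermap f sequentially))"
        unfolding eventually_inf by - (intro exI conjI, rule 1, rule 2, blast)
      with b show False by (simp add: trivial_limit_def)
    qed
    then obtain n where "n0 \<le> n" "\<forall>t\<in>T. t \<le> l n" "\<forall>t\<in>T. dist (f n t) (b t) < e" by blast
    moreover have "f n t = c n t" if "t \<in> T" for t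
      using T(2)[OF that] \<open>\<forall>t\<in>T. t \<le> l n\<close> that by (simp add: f_def)
    ultimately show ?thesis by (intro exI[of _ n]) simp
  qed
  show thesis
  proof
    show "\<exists>n\<ge>n0. R \<le> l n \<and> dist (c n R) (b R) < e" if "0 \<le> R" "0 < e" for R e n0
      using cluster[of "{R}" e n0] that by auto
    have "b 0 = x"
    proof (rule ccontr)
      assume "b 0 \<noteq> x"
      then obtain n where "dist (c n 0) (b 0) < dist x (b 0)"
        using cluster[of "{0}" "dist x (b 0)" 0] by auto
      then show False using c[of n] by (simp add: geodesic_path_def)
    qed
    then show "b 0 = x" .
    have "dist (b s) (b t) \<le> \<bar>s - t\<bar> + e \<and> \<bar>s - t\<bar> \<le> dist (b s) (b t) + e"
      if st: "0 \<le> s" "0 \<le> t" and e: "0 < e" for s t e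
    proof -
      obtain n where n: "s \<le> l n" "t \<le> l n" "dist (c n s) (b s) < e / 2" "dist (c n t) (b t) < e / 2"
        using cluster[of "{s, t}" "e / 2" 0] st e by auto
      have d: "dist (c n s) (c n t) = \<bar>s - t\<bar>"
        using geodesic_path_dist2[OF c[of n]] st n by blast
      have "dist (b s) (b t) \<le> dist (c n s) (b s) + dist (c n s) (c n t) + dist (c n t) (b t)"
        using dist_triangle3[of "b s" "b t" "c n s"] dist_triangle[of "c n s" "b t" "c n t"] by linarith
      moreover have "dist (c n s) (c n t) \<le> dist (c n s) (b s) + dist (b s) (b t) + dist (c n t) (b t)"
        using dist_triangle[of "c n s" "c n t" "b s"] dist_triangle2[of "b s" "c n t" "b t"] by linarith
      ultimately show ?thesis using n(3,4) unfolding d by (intro conjI) linarith+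
    qed
    then have "dist (b s) (b t) = \<bar>s - t\<bar>" if "0 \<le> s" "0 \<le> t" for s t
      using that by - (rule antisym; rule field_le_epsilon; simp)
    then show "geodesic_ray b" unfolding geodesic_ray_def by blast
  qed
qed


section \<open>The boundary and the cone topology\<close>

lemma asymptoticI:
  assumes "geodesic_ray c" "geodesic_ray c'" "\<And>t. 0 \<le> t \<Longrightarrow> dist (c t) (c' t) \<le> K"
  shows "(c, c') \<in> asymptotic"
  using assms unfolding asymptotic_def by auto

text \<open>The definition allows an arbitrary \<open>s\<close> for each \<open>t\<close>, but
  distances to the origins force \<bar>s - t\<bar> to be bounded, so the parameters can be
  synchronized. This also yields the symmetry that the one-sided definition hides.\<close>

lemma asymptoticD:
  assumes "(c, c') \<in> asymptotic"
  obtains K where "geodesic_ray c" "geodesic_ray c'" "\<And>t. 0 \<le> t \<Longrightarrow> dist (c t) (c' t) \<le> K"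
proof -
  obtain K where c: "geodesic_ray c" "geodesic_ray c'"
    and K: "\<And>t. 0 \<le> t \<Longrightarrow> \<exists>s\<ge>0. dist (c t) (c' s) \<le> K"
    using assms unfolding asymptotic_def by blast
  have "dist (c t) (c' t) \<le> 2 * K + dist (c 0) (c' 0)" if t: "0 \<le> t" for t
  proof -
    obtain s where s: "0 \<le> s" "dist (c t) (c' s) \<le> K" using K t by blast
    have "dist (c 0) (c t) = t" "dist (c' 0) (c' s) = s"
      using geodesic_ray_dist c t s by blast+
    then have "t \<le> dist (c 0) (c' 0) + s + K" "s \<le> dist (c 0) (c' 0) + t + K"
      using s dist_triangle[of "c 0" "c t" "c' 0"] dist_triangle2[of "c' 0" "c t" "c' s"]
        dist_triangle3[of "c' 0" "c' s" "c 0"] dist_triangle[of "c 0" "c' s" "c t"]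
      by linarith+
    moreover have "dist (c' s) (c' t) = \<bar>s - t\<bar>"
      using c s t unfolding geodesic_ray_def by blast
    ultimately show ?thesis
      using s dist_triangle[of "c t" "c' t" "c' s"] by linarith
  qed
  then show thesis using that c by blast
qed

lemma equiv_asymptotic: "equiv {c :: real \<Rightarrow> 'a::metric_space. geodesic_ray c} asymptotic"
proof (rule equivI)
  show "asymptotic \<subseteq> {c :: real \<Rightarrow> 'a. geodesic_ray c} \<times> {c. geodesic_ray c}"
    unfolding asymptotic_def by blast
  show "refl_on {c :: real \<Rightarrow> 'a. geodesic_ray c} asymptotic"
    by (auto intro!: refl_onI asymptoticI[of _ _ 0])
  show "sym (asymptotic :: ((real \<Rightarrow> 'a) \<times> _) set)"
  proof (rule symI)
    fix c c' :: "real \<Rightarrow> 'a" assume "(c, c') \<in> asymptotic"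
    then show "(c', c) \<in> asymptotic"
      by (elim asymptoticD) (auto intro: asymptoticI simp: dist_commute)
  qed
  show "trans (asymptotic :: ((real \<Rightarrow> 'a) \<times> _) set)"
  proof (rule transI)
    fix a b c :: "real \<Rightarrow> 'a" assume "(a, b) \<in> asymptotic" "(b, c) \<in> asymptotic"
    then obtain K L where *: "geodesic_ray a" "geodesic_ray c"
      "\<And>t. 0 \<le> t \<Longrightarrow> dist (a t) (b t) \<le> K" "\<And>t. 0 \<le> t \<Longrightarrow> dist (b t) (c t) \<le> L"
      using asymptoticD by metis
    have "dist (a t) (c t) \<le> K + L" if "0 \<le> t" for t
      using *(3,4)[OF that] dist_triangle[of "a t" "c t" "b t"] by linarith
    then show "(a, c) \<in> asymptotic" using * asymptoticI by blast
  qed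
qed

lemma boundary_ray:
  assumes "\<alpha> \<in> boundary" "c \<in> \<alpha>"
  shows "geodesic_ray c"
  using assms unfolding boundary_def by (auto simp: quotient_def asymptotic_def)

lemma boundary_asymptotic:
  assumes "\<alpha> \<in> boundary" "c \<in> \<alpha>" "c' \<in> \<alpha>"
  shows "(c, c') \<in> asymptotic"
  using assms quotient_eq_iff[OF equiv_asymptotic] unfolding boundary_def by blast

lemma boundary_closed:
  assumes "\<alpha> \<in> boundary" "c \<in> \<alpha>" "(c, c') \<in> asymptotic"
  shows "c' \<in> \<alpha>"
  using assms unfolding boundary_def by (meson equiv_asymptotic in_quotient_imp_closed)

lemma boundary_eqI:
  assumes "\<alpha> \<in> boundary" "\<beta> \<in> boundary" "c \<in> \<alpha>" "c' \<in> \<beta>" "(c, c') \<in> asymptotic"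
  shows "\<alpha> = \<beta>"
  using assms quotient_eqI[OF equiv_asymptotic] unfolding boundary_def by blast

lemma asymptotic_class:
  assumes "geodesic_ray c"
  shows "asymptotic `` {c} \<in> boundary" "c \<in> asymptotic `` {c}"
  using assms equiv_class_self[OF equiv_asymptotic] unfolding boundary_def
  by (auto intro: quotientI)

text \<open>A bound \<open>K\<close> valid arbitrarily far out contracts below any tolerance at
  \<open>t\<close>; the tolerance taken is the supposed positive distance itself.\<close>

lemma asymptotic_same_origin:
  fixes c c' :: "real \<Rightarrow> 'a::metric_space"
  assumes X: "CAT0_space TYPE('a)" and "(c, c') \<in> asymptotic" "c 0 = c' 0" "0 \<le> t"
  shows "c t = c' t"
proof (rule ccontr)
  assume ne: "c t \<noteq> c' t"
  obtain K where c: "geodesic_ray c" "geodesic_ray c'"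
    and K: "\<And>t. 0 \<le> t \<Longrightarrow> dist (c t) (c' t) \<le> K"
    using assms asymptoticD by metis
  have "0 \<le> K" using K[of 0] zero_le_dist[of "c 0" "c' 0"] by linarith
  then obtain S where S: "\<And>a a' :: real \<Rightarrow> 'a. \<And>l l' x y y' s s'.
     \<lbrakk>geodesic_path a l x y; geodesic_path a' l' x y'; 0 \<le> s; s \<le> l; 0 \<le> s'; s' \<le> l';
      dist (a s) (a' s') \<le> K; S \<le> s\<rbrakk> \<Longrightarrow> t < l \<and> t < l' \<and> dist (a t) (a' t) < dist (c t) (c' t)"
    using geodesics_close_eventually[OF X \<open>0 \<le> t\<close>, of K "dist (c t) (c' t)"] ne by auto
  define s where "s = max 0 S"
  have "geodesic_path c s (c 0) (c s)" "geodesic_path c' s (c 0) (c' s)"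
    using c assms(3) geodesic_ray_path[of c s] geodesic_ray_path[of c' s] by (auto simp: s_def)
  from S[OF this, of s s] K[of s] show False by (auto simp: s_def)
qed

text \<open>The ray is a limit of segments from \<open>x\<close> to the points \<open>c n\<close>.
  Seen from its far end, each segment shares its origin with the reversed ray, so it stays within a
  distance of \<open>c\<close> that is controlled by \<open>dist x (c 0)\<close>.\<close>

lemma asymptotic_ray_from:
  fixes c :: "real \<Rightarrow> 'a::metric_space"
  assumes X: "CAT0_space TYPE('a)" and c: "geodesic_ray c"
  obtains b where "(c, b) \<in> asymptotic" "b 0 = x"
proof -
  define l where "l n = dist x (c (real n))" for n
  obtain a where a: "\<And>n. geodesic_path (a n) (l n) x (c (real n))"
    unfolding l_def by (rule geodesic_paths_exist[OF X, of x "\<lambda>n. c (real n)"]) blast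
  define D where "D = dist x (c 0)"
  have cn: "dist (c 0) (c (real n)) = real n" for n using geodesic_ray_dist[OF c] by simp
  have l: "\<bar>l n - real n\<bar> \<le> D" for n
    using dist_triangle[of x "c (real n)" "c 0"] dist_triangle3[of "c 0" "c (real n)" x] cn[of n]
    by (simp add: l_def D_def)
  have close: "dist (a n t) (c t) \<le> 3 * D" if t: "0 \<le> t" "t + D < real n" for n t
  proof -
    have D0: "0 \<le> D" by (simp add: D_def)
    have p: "geodesic_path (\<lambda>s. a n (l n - s)) (l n) (c (real n)) x"
      using geodesic_path_reverse[OF a] .
    have q: "geodesic_path (\<lambda>s. c (real n - s)) (real n) (c (real n)) (c 0)"
      using geodesic_path_reverse[OF geodesic_ray_path[OF c]] by simp
    have *: "0 \<le> l n - t" "l n - t \<le> l n" using l[of n] t D0 by linarith+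
    show ?thesis
    \<comment> \<open>The comparison from \<open>c n\<close> reaches only as far as the shorter of
      the two paths. The bound \<open>3 * D\<close> consists of \<open>dist x (c 0)\<close>, one
      \<bar>l n - n\<bar> for the missing end piece and one for the shift of parameter.\<close>
    proof (cases "l n \<le> real n")
      case True
      have "dist (a n (l n - (l n - t))) (c (real n - (l n - t)))
          \<le> dist (a n (l n - l n)) (c (real n - l n))"
        using geodesics_diverge_le[OF X p q, of "l n - t" "l n"] * True by simp
      then have "dist (a n t) (c (real n - l n + t)) \<le> dist x (c (real n - l n))"
        using a[of n] by (simp add: geodesic_path_def algebra_simps)
      moreover have "dist (c (real n - l n + t)) (c t) = real n - l n"
        "dist (c 0) (c (real n - l n)) = real n - l n"
        using c t True by (auto simp: geodesic_ray_def)
      ultimately show ?thesis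
        using l[of n] True D_def dist_triangle[of x "c (real n - l n)" "c 0"]
          dist_triangle[of "a n t" "c t" "c (real n - l n + t)"] by linarith
    next
      case False
      define u where "u = real n - t"
      have u: "0 \<le> u" "u \<le> real n" using t D0 by (auto simp: u_def)
      have "dist (a n (l n - u)) (c (real n - u))
          \<le> dist (a n (l n - real n)) (c (real n - real n))"
        using geodesics_diverge_le[OF X p q, of u "real n"] u False by simp
      moreover have "dist (a n (l n - u)) (a n t) = l n - real n"
        "dist x (a n (l n - real n)) = l n - real n"
        using geodesic_path_dist2[OF a[of n], of "l n - u" t]
          geodesic_path_dist[OF a[of n], of "l n - real n"] t u False
        by (auto simp: u_def)
      ultimately show ?thesis
        using l[of n] False D_def dist_triangle3[of "a n (l n - real n)" "c 0" x]
          dist_triangle3[of "a n t" "c t" "a n (l n - u)"] by (simp add: u_def)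
    qed
  qed
  have "filterlim l at_top sequentially"
  proof (rule filterlim_ge_shift)
    show "real n - D \<le> l n" for n using l[of n] by linarith
  qed
  then obtain b where b: "geodesic_ray b" "b 0 = x"
    and lim: "\<And>R e n0. \<lbrakk>0 \<le> R; 0 < e\<rbrakk> \<Longrightarrow> \<exists>n\<ge>n0. R \<le> l n \<and> dist (a n R) (b R) < e"
    using limit_ray[of a l x "\<lambda>n. c (real n)"] a X unfolding CAT0_space_def by metis
  have "dist (c t) (b t) \<le> 3 * D + 1" if t: "0 \<le> t" for t
  proof -
    obtain n0 where "t + D < real n0" using reals_Archimedean2 by blast
    moreover obtain n where "n \<ge> n0" "dist (a n t) (b t) < 1" using lim[OF t] zero_less_one by blast
    ultimately have "dist (a n t) (c t) \<le> 3 * D" "dist (a n t) (b t) < 1"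
      using close t by auto
    then show ?thesis using dist_triangle3[of "c t" "b t" "a n t"] by linarith
  qed
  then show thesis using that b c asymptoticI by blast
qed

lemma boundary_ray_from:
  fixes \<alpha> :: "(real \<Rightarrow> 'a::metric_space) set"
  assumes X: "CAT0_space TYPE('a)" and \<alpha>: "\<alpha> \<in> boundary"
  obtains c where "c \<in> \<alpha>" "c 0 = x" "geodesic_ray c"
proof -
  obtain c where "c \<in> \<alpha>" "geodesic_ray c"
    using \<alpha> equiv_class_self[OF equiv_asymptotic] unfolding boundary_def
    by (auto elim!: quotientE)
  then show thesis
    using asymptotic_ray_from[OF X] boundary_closed[OF \<alpha>] boundary_ray[OF \<alpha>] that by metis
qed

section \<open>Cone neighborhoods as open test sets\<close>

lemma geodesic_to_unique:
  fixes x\<^sub>0 :: "'a::metric_space"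
  assumes X: "CAT0_space TYPE('a)" and c: "geodesic_to x\<^sub>0 x c" "geodesic_to x\<^sub>0 x c'"
    and x: "x \<in> bordification" "x \<notin> Inl ` cball x\<^sub>0 r" "0 \<le> r"
  shows "c r = c' r"
proof (cases x)
  case (Inl p)
  then show ?thesis
    using geodesic_path_unique[OF X] c x by (fastforce simp: geodesic_to_def mem_cball)
next
  case (Inr \<alpha>)
  then have "\<alpha> \<in> boundary" using x by (auto simp: bordification_def)
  then show ?thesis
    using asymptotic_same_origin[OF X boundary_asymptotic] Inr c x by (auto simp: geodesic_to_def)
qed

lemma geodesic_to_exists:
  fixes x\<^sub>0 :: "'a::metric_space"
  assumes X: "CAT0_space TYPE('a)" and x: "x \<in> bordification"
  obtains c where "geodesic_to x\<^sub>0 x c"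
proof (cases x)
  case (Inl p)
  then show thesis using geodesic_path_exists[OF X] that by (auto simp: geodesic_to_def)
next
  case (Inr \<alpha>)
  then have "\<alpha> \<in> boundary" using x by (auto simp: bordification_def)
  then show thesis
    using boundary_ray_from[OF X, of \<alpha> x\<^sub>0] that Inr by (auto simp: geodesic_to_def)
qed

text \<open>By uniqueness of geodesics, the existentially quantified representatives in
  \<open>cone_nbhd\<close> can be replaced by any chosen ones.\<close>

lemma cone_nbhd_iff:
  fixes x\<^sub>0 :: "'a::metric_space"
  assumes X: "CAT0_space TYPE('a)" and \<alpha>: "\<alpha> \<in> boundary" "c \<in> \<alpha>" "c 0 = x\<^sub>0"
    and x: "x \<in> bordification" "geodesic_to x\<^sub>0 x c'" and r: "0 \<le> r"
  shows "x \<in> cone_nbhd x\<^sub>0 \<epsilon> \<alpha> r \<longleftrightarrow> x \<notin> Inl ` cball x\<^sub>0 r \<and> dist (c r) (c' r) < \<epsilon>"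
proof -
  have a: "geodesic_to x\<^sub>0 (Inr \<alpha>) c" "Inr \<alpha> \<in> bordification" "Inr \<alpha> \<notin> Inl ` cball x\<^sub>0 r"
    using \<alpha> by (auto simp: geodesic_to_def bordification_def)
  then have 1: "a r = c r" if "geodesic_to x\<^sub>0 (Inr \<alpha>) a" for a
    using geodesic_to_unique[OF X that] r by blast
  have 2: "a r = c' r" if "geodesic_to x\<^sub>0 x a" "x \<notin> Inl ` cball x\<^sub>0 r" for a
    using geodesic_to_unique[OF X that(1)] x r that by blast
  show ?thesis
  proof
    assume "x \<in> cone_nbhd x\<^sub>0 \<epsilon> \<alpha> r"
    then obtain b b' where b: "x \<notin> Inl ` cball x\<^sub>0 r" "geodesic_to x\<^sub>0 (Inr \<alpha>) b"
      "geodesic_to x\<^sub>0 x b'" "dist (b r) (b' r) < \<epsilon>"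
      unfolding cone_nbhd_def by blast
    then show "x \<notin> Inl ` cball x\<^sub>0 r \<and> dist (c r) (c' r) < \<epsilon>"
      using 1[OF b(2)] 2[OF b(3,1)] by simp
  next
    assume "x \<notin> Inl ` cball x\<^sub>0 r \<and> dist (c r) (c' r) < \<epsilon>"
    then show "x \<in> cone_nbhd x\<^sub>0 \<epsilon> \<alpha> r"
      using a(1) x unfolding cone_nbhd_def by blast
  qed
qed

lemma cone_nbhd_Inr_iff:
  fixes x\<^sub>0 :: "'a::metric_space"
  assumes X: "CAT0_space TYPE('a)" and \<alpha>: "\<alpha> \<in> boundary" "c \<in> \<alpha>" "c 0 = x\<^sub>0"
    and \<beta>: "\<beta> \<in> boundary" "c' \<in> \<beta>" "c' 0 = x\<^sub>0" and r: "0 \<le> r"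
  shows "Inr \<beta> \<in> cone_nbhd x\<^sub>0 \<epsilon> \<alpha> r \<longleftrightarrow> dist (c r) (c' r) < \<epsilon>"
  by (subst cone_nbhd_iff[OF X \<alpha> _ _ r, of _ c'])
    (use \<beta> in \<open>auto simp: bordification_def geodesic_to_def\<close>)

lemma cone_nbhd_Inl_iff:
  fixes x\<^sub>0 :: "'a::metric_space"
  assumes X: "CAT0_space TYPE('a)" and \<alpha>: "\<alpha> \<in> boundary" "c \<in> \<alpha>" "c 0 = x\<^sub>0"
    and c': "geodesic_path c' l x\<^sub>0 p" and r: "0 \<le> r"
  shows "Inl p \<in> cone_nbhd x\<^sub>0 \<epsilon> \<alpha> r \<longleftrightarrow> r < l \<and> dist (c r) (c' r) < \<epsilon>"
proof -
  have "l = dist x\<^sub>0 p" using geodesic_path_length[OF c'] .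
  then show ?thesis
    by (subst cone_nbhd_iff[OF X \<alpha> _ _ r, of _ c'])
      (use c' in \<open>auto simp: bordification_def geodesic_to_def mem_cball\<close>)
qed

text \<open>The lengths differ by at most \<open>dist p q\<close>; cutting both geodesics at the
  shorter length costs this amount once more, whence the factor 2.\<close>

lemma geodesics_continuous:
  fixes c c' :: "real \<Rightarrow> 'a::metric_space"
  assumes X: "CAT0_space TYPE('a)"
    and c: "geodesic_path c l x p" and c': "geodesic_path c' l' x q"
    and r: "0 \<le> r" "r \<le> l" "r \<le> l'"
  shows "dist (c r) (c' r) \<le> 2 * dist p q"
proof -
  define m where "m = min l l'"
  have m: "r \<le> m" "m \<le> l" "m \<le> l'" "0 \<le> m" using r by (auto simp: m_def)
  have ll: "\<bar>l - l'\<bar> \<le> dist p q"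
    using geodesic_path_length[OF c] geodesic_path_length[OF c']
      dist_triangle[of x p q] dist_triangle[of x q p] by (simp add: dist_commute)
  have "dist (c m) p = l - m" "dist (c' m) q = l' - m"
    using geodesic_path_dist2[OF c, of m l] geodesic_path_dist2[OF c', of m l'] c c' m
    by (auto simp: geodesic_path_def)
  then have "dist (c m) (c' m) \<le> (l - m) + dist p q + (l' - m)"
    using dist_triangle[of "c m" "c' m" p] dist_triangle2[of p "c' m" q] by linarith
  also have "\<dots> \<le> 2 * dist p q" using ll by (auto simp: m_def)
  finally show ?thesis using geodesics_diverge_le[OF X c c' r(1) m(1,2,3)] by linarith
qed

text \<open>Both conditions in \<open>cone_nbhd\<close> are strict, which gives openness in X; at
  boundary points, contraction absorbs the fixed tolerance. Openness is what lets limits and open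
  sets be tested on the sets \<open>cone_nbhd\<close> themselves.\<close>

lemma cone_open_cone_nbhd:
  fixes x\<^sub>0 :: "'a::metric_space"
  assumes X: "CAT0_space TYPE('a)" and \<alpha>: "\<alpha> \<in> boundary" and r: "0 < r" and e: "0 < \<epsilon>"
  shows "cone_open x\<^sub>0 \<epsilon> (cone_nbhd x\<^sub>0 \<epsilon> \<alpha> r)"
  unfolding cone_open_def
proof (intro conjI ballI impI)
  obtain a where a: "a \<in> \<alpha>" "a 0 = x\<^sub>0" "geodesic_ray a" using boundary_ray_from[OF X \<alpha>] .
  show "cone_nbhd x\<^sub>0 \<epsilon> \<alpha> r \<subseteq> bordification" by (auto simp: cone_nbhd_def)
  show "open (Inl -` cone_nbhd x\<^sub>0 \<epsilon> \<alpha> r :: 'a set)"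
    unfolding open_dist
  proof
    fix p :: 'a assume p: "p \<in> Inl -` cone_nbhd x\<^sub>0 \<epsilon> \<alpha> r"
    obtain c where c: "geodesic_path c (dist x\<^sub>0 p) x\<^sub>0 p" using geodesic_path_exists[OF X] .
    have d: "r < dist x\<^sub>0 p" "dist (a r) (c r) < \<epsilon>"
      using p cone_nbhd_Inl_iff[OF X \<alpha> a(1,2) c] r by auto
    \<comment> \<open>The first term keeps \<open>q\<close> outside the ball; the second halves the
      remaining slack because of the factor 2 in \<open>geodesics_continuous\<close>.\<close>
    define \<delta> where "\<delta> = min (dist x\<^sub>0 p - r) ((\<epsilon> - dist (a r) (c r)) / 2)"
    have "q \<in> Inl -` cone_nbhd x\<^sub>0 \<epsilon> \<alpha> r" if q: "dist q p < \<delta>" for q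
    proof -
      obtain b where b: "geodesic_path b (dist x\<^sub>0 q) x\<^sub>0 q" using geodesic_path_exists[OF X] .
      have "r < dist x\<^sub>0 q" using q dist_triangle[of x\<^sub>0 p q] by (simp add: \<delta>_def)
      moreover have "dist (c r) (b r) \<le> 2 * dist p q"
        using geodesics_continuous[OF X c b] r d calculation by simp
      then have "dist (a r) (b r) < \<epsilon>"
        using q dist_triangle[of "a r" "b r" "c r"] by (simp add: \<delta>_def dist_commute)
      ultimately show ?thesis using cone_nbhd_Inl_iff[OF X \<alpha> a(1,2) b] r by simp
    qed
    moreover have "0 < \<delta>" using d by (simp add: \<delta>_def)
    ultimately show "\<exists>e>0. \<forall>q. dist q p < e \<longrightarrow> q \<in> Inl -` cone_nbhd x\<^sub>0 \<epsilon> \<alpha> r" by blast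
  qed
  fix \<beta> :: "(real \<Rightarrow> 'a) set"
  assume \<beta>: "\<beta> \<in> boundary" "Inr \<beta> \<in> cone_nbhd x\<^sub>0 \<epsilon> \<alpha> r"
  obtain b where b: "b \<in> \<beta>" "b 0 = x\<^sub>0" "geodesic_ray b" using boundary_ray_from[OF X \<beta>(1)] .
  have d: "dist (a r) (b r) < \<epsilon>"
    using \<beta>(2) cone_nbhd_Inr_iff[OF X \<alpha> a(1,2) \<beta>(1) b(1,2)] r by simp
  \<comment> \<open>A discrepancy \<open>\<epsilon>\<close> at \<open>R\<close> contracts at
    \<open>r\<close> to \<open>r / R * \<epsilon>\<close>, which is at most the slack left between
    \<open>a\<close> and \<open>b\<close>.\<close>
  define R where "R = max r (r * \<epsilon> / (\<epsilon> - dist (a r) (b r)))"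
  have R: "r \<le> R" "r * \<epsilon> \<le> (\<epsilon> - dist (a r) (b r)) * R"
    using d by (auto simp: R_def field_simps max_def)
  have "cone_nbhd x\<^sub>0 \<epsilon> \<beta> R \<subseteq> cone_nbhd x\<^sub>0 \<epsilon> \<alpha> r"
  proof
    fix x assume x: "x \<in> cone_nbhd x\<^sub>0 \<epsilon> \<beta> R"
    then have xb: "x \<in> bordification" by (simp add: cone_nbhd_def)
    obtain c where c: "geodesic_to x\<^sub>0 x c" using geodesic_to_exists[OF X xb] .
    have xR: "x \<notin> Inl ` cball x\<^sub>0 R" "dist (b R) (c R) < \<epsilon>"
      using x cone_nbhd_iff[OF X \<beta>(1) b(1,2) xb c] R r by auto
    have "geodesic_path c R x\<^sub>0 (c R)"
      using geodesic_to_path[OF c xb xR(1)] R r by simp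
    moreover have "geodesic_path b R x\<^sub>0 (b R)" using geodesic_ray_path[OF b(3), of R] b R r by simp
    ultimately have "dist (b r) (c r) \<le> r / R * dist (b R) (c R)"
      using geodesics_contract[OF X] R r by simp
    also have "\<dots> < r / R * \<epsilon>" using xR R r by (intro mult_strict_left_mono) auto
    also have "\<dots> \<le> \<epsilon> - dist (a r) (b r)" using R r by (simp add: field_simps)
    finally have "dist (a r) (c r) < \<epsilon>" using dist_triangle[of "a r" "c r" "b r"] by linarith
    moreover have "x \<notin> Inl ` cball x\<^sub>0 r" using xR R by (auto simp: mem_cball)
    ultimately show "x \<in> cone_nbhd x\<^sub>0 \<epsilon> \<alpha> r"
      using cone_nbhd_iff[OF X \<alpha> a(1,2) xb c] r by simp
  qed
  then show "\<exists>R>0. cone_nbhd x\<^sub>0 \<epsilon> \<beta> R \<subseteq> cone_nbhd x\<^sub>0 \<epsilon> \<alpha> r" using R r by (intro exI[of _ R]) simp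
qed

lemma Inr_in_cone_nbhd:
  fixes x\<^sub>0 :: "'a::metric_space"
  assumes X: "CAT0_space TYPE('a)" and \<alpha>: "\<alpha> \<in> boundary" and "0 \<le> r" and "0 < \<epsilon>"
  shows "Inr \<alpha> \<in> cone_nbhd x\<^sub>0 \<epsilon> \<alpha> r"
proof -
  obtain a where a: "a \<in> \<alpha>" "a 0 = x\<^sub>0" using boundary_ray_from[OF X \<alpha>] .
  show ?thesis using cone_nbhd_Inr_iff[OF X \<alpha> a \<alpha> a] assms by simp
qed

lemma limitin_cone_topology_iff:
  fixes x\<^sub>0 :: "'a::metric_space"
  assumes X: "CAT0_space TYPE('a)" and \<alpha>: "\<alpha> \<in> boundary" and e: "0 < \<epsilon>"
  shows "limitin (cone_topology x\<^sub>0 \<epsilon>) f (Inr \<alpha>) F \<longleftrightarrow>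
    (\<forall>r>0. \<forall>\<^sub>F i in F. f i \<in> cone_nbhd x\<^sub>0 \<epsilon> \<alpha> r)"
proof
  assume "limitin (cone_topology x\<^sub>0 \<epsilon>) f (Inr \<alpha>) F"
  then show "\<forall>r>0. \<forall>\<^sub>F i in F. f i \<in> cone_nbhd x\<^sub>0 \<epsilon> \<alpha> r"
    unfolding limitin_def openin_cone_topology[OF X]
    using cone_open_cone_nbhd[OF X \<alpha> _ e] Inr_in_cone_nbhd[OF X \<alpha> _ e] by auto
next
  assume *: "\<forall>r>0. \<forall>\<^sub>F i in F. f i \<in> cone_nbhd x\<^sub>0 \<epsilon> \<alpha> r"
  show "limitin (cone_topology x\<^sub>0 \<epsilon>) f (Inr \<alpha>) F"
    unfolding limitin_def openin_cone_topology[OF X] topspace_cone_topology[OF X]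
  proof (intro conjI allI impI)
    show "Inr \<alpha> \<in> bordification" using \<alpha> by (simp add: bordification_def)
    fix U assume "cone_open x\<^sub>0 \<epsilon> U \<and> Inr \<alpha> \<in> U"
    then obtain r where "r > 0" "cone_nbhd x\<^sub>0 \<epsilon> \<alpha> r \<subseteq> U"
      using \<alpha> unfolding cone_open_def by blast
    then show "\<forall>\<^sub>F i in F. f i \<in> U" using * by (meson eventually_mono subsetD)
  qed
qed

lemma openin_boundary_topology_iff:
  fixes x\<^sub>0 :: "'a::metric_space"
  assumes X: "CAT0_space TYPE('a)" and e: "0 < \<epsilon>"
  shows "openin (boundary_topology x\<^sub>0 \<epsilon>) S \<longleftrightarrow> S \<subseteq> boundary \<and>
    (\<forall>\<alpha>\<in>S. \<exists>r>0. \<forall>\<beta>\<in>boundary. Inr \<beta> \<in> cone_nbhd x\<^sub>0 \<epsilon> \<alpha> r \<longrightarrow> \<beta> \<in> S)"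
proof
  assume "openin (boundary_topology x\<^sub>0 \<epsilon>) S"
  then obtain U where U: "cone_open x\<^sub>0 \<epsilon> U" "S = Inr -` U \<inter> boundary"
    unfolding boundary_topology_def openin_pullback_topology openin_cone_topology[OF X] by blast
  have "\<exists>r>0. \<forall>\<beta>\<in>boundary. Inr \<beta> \<in> cone_nbhd x\<^sub>0 \<epsilon> \<alpha> r \<longrightarrow> \<beta> \<in> S" if \<alpha>: "\<alpha> \<in> S" for \<alpha>
  proof -
    obtain r where "r > 0" "cone_nbhd x\<^sub>0 \<epsilon> \<alpha> r \<subseteq> U"
      using \<alpha> U unfolding cone_open_def by blast
    then show ?thesis unfolding U(2) by (intro exI[of _ r]) auto
  qed
  then show "S \<subseteq> boundary \<and>
    (\<forall>\<alpha>\<in>S. \<exists>r>0. \<forall>\<beta>\<in>boundary. Inr \<beta> \<in> cone_nbhd x\<^sub>0 \<epsilon> \<alpha> r \<longrightarrow> \<beta> \<in> S)"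
    using U(2) by simp
next
  assume S: "S \<subseteq> boundary \<and>
    (\<forall>\<alpha>\<in>S. \<exists>r>0. \<forall>\<beta>\<in>boundary. Inr \<beta> \<in> cone_nbhd x\<^sub>0 \<epsilon> \<alpha> r \<longrightarrow> \<beta> \<in> S)"
  then obtain \<rho> where \<rho>: "\<And>\<alpha>. \<alpha> \<in> S \<Longrightarrow> \<rho> \<alpha> > 0"
    "\<And>\<alpha> \<beta>. \<lbrakk>\<alpha> \<in> S; \<beta> \<in> boundary; Inr \<beta> \<in> cone_nbhd x\<^sub>0 \<epsilon> \<alpha> (\<rho> \<alpha>)\<rbrakk> \<Longrightarrow> \<beta> \<in> S"
    by metis
  define U where "U = (\<Union>\<alpha>\<in>S. cone_nbhd x\<^sub>0 \<epsilon> \<alpha> (\<rho> \<alpha>))"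
  have "openin (cone_topology x\<^sub>0 \<epsilon>) U"
    unfolding U_def using cone_open_cone_nbhd[OF X _ _ e] openin_cone_topology[OF X] S \<rho>
    by (intro openin_Union) auto
  moreover have "S = Inr -` U \<inter> boundary"
  proof
    show "S \<subseteq> Inr -` U \<inter> boundary"
    proof
      fix \<alpha> assume \<alpha>: "\<alpha> \<in> S"
      then have "\<alpha> \<in> boundary" using S by blast
      then have "Inr \<alpha> \<in> cone_nbhd x\<^sub>0 \<epsilon> \<alpha> (\<rho> \<alpha>)"
        using Inr_in_cone_nbhd[OF X _ _ e] \<rho>(1)[OF \<alpha>] by simp
      then show "\<alpha> \<in> Inr -` U \<inter> boundary" using \<alpha> \<open>\<alpha> \<in> boundary\<close> by (auto simp: U_def)
    qed
    show "Inr -` U \<inter> boundary \<subseteq> S" using \<rho>(2) by (auto simp: U_def)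
  qed
  ultimately show "openin (boundary_topology x\<^sub>0 \<epsilon>) S"
    unfolding boundary_topology_def openin_pullback_topology by blast
qed


section \<open>Coarsely equivalent orbits\<close>

text \<open>Both orbits are indexed by \<open>A\<close> instead of being linked by a map between
  them: with different stabilizers, a point of one orbit may belong to several points of the
  other.\<close>

definition coarse_map_on :: "'g set \<Rightarrow> ('g \<Rightarrow> 'a::metric_space) \<Rightarrow> ('g \<Rightarrow> 'b::metric_space) \<Rightarrow> bool" where
  "coarse_map_on A u v \<longleftrightarrow>
     (\<forall>C. \<exists>C'. \<forall>a\<in>A. \<forall>b\<in>A. dist (u a) (u b) \<le> C \<longrightarrow> dist (v a) (v b) \<le> C')"

text \<open>The parameter \<open>s\<close> need not depend monotonically on \<open>t\<close>, and
  only the points of \<open>\<xi>\<close> are required to be covered; the covering of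
  \<open>\<eta>\<close> is recovered in \<open>shadows_converse\<close>.\<close>

definition shadows ::
  "'g set \<Rightarrow> ('g \<Rightarrow> 'a::metric_space) \<Rightarrow> ('g \<Rightarrow> 'b::metric_space) \<Rightarrow> real \<Rightarrow>
   (real \<Rightarrow> 'a) \<Rightarrow> (real \<Rightarrow> 'b) \<Rightarrow> bool" where
  "shadows A u v K \<xi> \<eta> \<longleftrightarrow>
     (\<forall>t\<ge>0. \<exists>s\<ge>0. \<exists>a\<in>A. dist (u a) (\<xi> t) \<le> K \<and> dist (v a) (\<eta> s) \<le> K)"

lemma shadowsE:
  assumes "shadows A u v K \<xi> \<eta>" "0 \<le> t"
  obtains s a where "0 \<le> s" "a \<in> A" "dist (u a) (\<xi> t) \<le> K" "dist (v a) (\<eta> s) \<le> K"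
  using assms unfolding shadows_def by blast

lemma shadows_mono:
  assumes "shadows A u v K \<xi> \<eta>" "K \<le> L"
  shows "shadows A u v L \<xi> \<eta>"
  using assms unfolding shadows_def by (meson order_trans)

text \<open>For equivariance: a translated pair of rays leaves the base points and has to be
  replaced by asymptotic rays issuing from them, with a bound that may grow.\<close>

lemma shadows_asymptotic:
  assumes "shadows A u v K \<xi> \<eta>" "(\<xi>, \<xi>') \<in> asymptotic" "(\<eta>, \<eta>') \<in> asymptotic"
  obtains L where "shadows A u v L \<xi>' \<eta>'"
proof -
  obtain P where P: "\<And>t. 0 \<le> t \<Longrightarrow> dist (\<xi> t) (\<xi>' t) \<le> P" using asymptoticD[OF assms(2)] by blast
  obtain Q where Q: "\<And>t. 0 \<le> t \<Longrightarrow> dist (\<eta> t) (\<eta>' t) \<le> Q" using asymptoticD[OF assms(3)] by blast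
  have "shadows A u v (K + max P Q) \<xi>' \<eta>'"
    unfolding shadows_def
  proof (intro allI impI)
    fix t :: real assume t: "0 \<le> t"
    obtain s a where s: "0 \<le> s" "a \<in> A" "dist (u a) (\<xi> t) \<le> K" "dist (v a) (\<eta> s) \<le> K"
      using shadowsE[OF assms(1) t] .
    have "dist (u a) (\<xi>' t) \<le> K + max P Q" "dist (v a) (\<eta>' s) \<le> K + max P Q"
      using s P[OF t] Q[OF s(1)] dist_triangle[of "u a" "\<xi>' t" "\<xi> t"]
        dist_triangle[of "v a" "\<eta>' s" "\<eta> s"] by linarith+
    then show "\<exists>s\<ge>0. \<exists>a\<in>A. dist (u a) (\<xi>' t) \<le> K + max P Q \<and> dist (v a) (\<eta>' s) \<le> K + max P Q"
      using s by blast
  qed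
  then show thesis by (rule that)
qed

text \<open>The assumptions are symmetric in the two spaces, so every result is available in both
  directions through \<open>swapped\<close>. The one-sided hypothesis is kept apart in
  \<open>segment_shadows\<close>.\<close>

locale coarse_orbits =
  fixes A :: "'g set" and u :: "'g \<Rightarrow> 'x::metric_space" and v :: "'g \<Rightarrow> 'y::metric_space"
    and x\<^sub>0 :: 'x and y\<^sub>0 :: 'y
  assumes X: "CAT0_space TYPE('x)" and Y: "CAT0_space TYPE('y)"
    and coarse_uv: "coarse_map_on A u v" and coarse_vu: "coarse_map_on A v u"
    and base: "\<exists>b\<in>A. u b = x\<^sub>0 \<and> v b = y\<^sub>0"
begin

lemma swapped: "coarse_orbits A v u y\<^sub>0 x\<^sub>0"
  using X Y coarse_uv coarse_vu base by unfold_locales auto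

lemma dist_v_bound:
  obtains C where "\<And>a b. \<lbrakk>a \<in> A; b \<in> A; dist (u a) (u b) \<le> K\<rbrakk> \<Longrightarrow> dist (v a) (v b) \<le> C"
  using coarse_uv unfolding coarse_map_on_def by meson

lemma dist_origin_v_bound:
  obtains C where "\<And>a. \<lbrakk>a \<in> A; dist x\<^sub>0 (u a) \<le> K\<rbrakk> \<Longrightarrow> dist y\<^sub>0 (v a) \<le> C"
  using dist_v_bound[of K] base by metis

lemma dist_origin_u_bound:
  obtains C where "\<And>a. \<lbrakk>a \<in> A; dist y\<^sub>0 (v a) \<le> K\<rbrakk> \<Longrightarrow> dist x\<^sub>0 (u a) \<le> C"
  using coarse_orbits.dist_origin_v_bound[OF swapped] by blast

text \<open>Nearness and remoteness are measured in X, the conclusion lives in Y: close orbit points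
  stay close by \<open>coarse_uv\<close>, remote ones stay remote by \<open>coarse_vu\<close>, and
  contraction in Y does the rest.\<close>

lemma geodesics_near_orbit_close:
  assumes r: "0 \<le> r" and K: "0 \<le> K" and e: "0 < e"
  obtains R where "0 < R"
    "\<And>a a' c c' l l' y y' s s'. \<lbrakk>a \<in> A; a' \<in> A; geodesic_path c l y\<^sub>0 y; geodesic_path c' l' y\<^sub>0 y';
       0 \<le> s; s \<le> l; 0 \<le> s'; s' \<le> l'; dist (u a) (u a') \<le> K; dist (v a) (c s) \<le> K;
       dist (v a') (c' s') \<le> K; R \<le> dist x\<^sub>0 (u a)\<rbrakk> \<Longrightarrow> r < l \<and> r < l' \<and> dist (c r) (c' r) < e"
proof -
  obtain C where C: "\<And>a b. \<lbrakk>a \<in> A; b \<in> A; dist (u a) (u b) \<le> K\<rbrakk> \<Longrightarrow> dist (v a) (v b) \<le> C"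
    using dist_v_bound[of K] by blast
  \<comment> \<open>One \<open>K\<close> from each geodesic to its orbit point, and \<open>C\<close>
    between the two orbit points.\<close>
  define L where "L = 2 * K + \<bar>C\<bar>"
  have "0 \<le> L" using K by (simp add: L_def)
  then obtain S where S: "\<And>c c' l l' (x::'y) y y' s s'.
     \<lbrakk>geodesic_path c l x y; geodesic_path c' l' x y'; 0 \<le> s; s \<le> l; 0 \<le> s'; s' \<le> l';
      dist (c s) (c' s') \<le> L; S \<le> s\<rbrakk> \<Longrightarrow> r < l \<and> r < l' \<and> dist (c r) (c' r) < e"
    using geodesics_close_eventually[OF Y r _ e] by metis
  obtain D where D: "\<And>a. \<lbrakk>a \<in> A; dist y\<^sub>0 (v a) \<le> S + K\<rbrakk> \<Longrightarrow> dist x\<^sub>0 (u a) \<le> D"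
    using dist_origin_u_bound[of "S + K"] by blast
  show thesis
  proof
    show "0 < \<bar>D\<bar> + 1" by simp
    fix a a' c c' l l' y y' s s'
    assume a: "a \<in> A" "a' \<in> A" and c: "geodesic_path c l y\<^sub>0 y" "geodesic_path c' l' y\<^sub>0 y'"
      and s: "0 \<le> s" "s \<le> l" "0 \<le> s'" "s' \<le> l'"
      and d: "dist (u a) (u a') \<le> K" "dist (v a) (c s) \<le> K" "dist (v a') (c' s') \<le> K"
      and far: "\<bar>D\<bar> + 1 \<le> dist x\<^sub>0 (u a)"
    have "dist (c s) (c' s') \<le> dist (v a) (c s) + dist (v a) (v a') + dist (v a') (c' s')"
      using dist_triangle3[of "c s" "c' s'" "v a"] dist_triangle[of "v a" "c' s'" "v a'"] by linarith
    also have "\<dots> \<le> L" using d C[OF a d(1)] by (simp add: L_def)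
    finally have "dist (c s) (c' s') \<le> L" .
    moreover have "S \<le> s"
    proof -
      have "S + K < dist y\<^sub>0 (v a)" using D[OF a(1)] far by fastforce
      moreover have "dist y\<^sub>0 (v a) \<le> s + K"
        using geodesic_path_dist[OF c(1) s(1,2)] d dist_triangle2[of y\<^sub>0 "v a" "c s"] by linarith
      ultimately show ?thesis by linarith
    qed
    ultimately show "r < l \<and> r < l' \<and> dist (c r) (c' r) < e" using S[OF c s] by blast
  qed
qed

text \<open>The tolerance \<open>\<delta>\<close> in X is unrelated to \<open>e\<close> in Y. With
  \<open>\<delta> = 0\<close> this gives well-definedness of the correspondence, with
  \<open>\<delta> = \<epsilon>\<close> its continuity.\<close>

lemma shadows_close:
  assumes r: "0 \<le> r" and K: "0 \<le> K" and d: "0 \<le> \<delta>" and e: "0 < e"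
  obtains R where "0 < R"
    "\<And>\<xi> \<xi>' \<eta> \<eta>'. \<lbrakk>geodesic_ray \<xi>; geodesic_ray \<eta>; geodesic_ray \<eta>'; \<xi> 0 = x\<^sub>0; \<eta> 0 = y\<^sub>0; \<eta>' 0 = y\<^sub>0;
       shadows A u v K \<xi> \<eta>; shadows A u v K \<xi>' \<eta>'; dist (\<xi> R) (\<xi>' R) \<le> \<delta>\<rbrakk>
       \<Longrightarrow> dist (\<eta> r) (\<eta>' r) < e"
proof -
  define L where "L = 2 * K + \<delta>"
  have "0 \<le> L" using K d by (simp add: L_def)
  then obtain R where R: "0 < R"
    "\<And>a a' c c' l l' y y' s s'. \<lbrakk>a \<in> A; a' \<in> A; geodesic_path c l y\<^sub>0 y; geodesic_path c' l' y\<^sub>0 y';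
       0 \<le> s; s \<le> l; 0 \<le> s'; s' \<le> l'; dist (u a) (u a') \<le> L; dist (v a) (c s) \<le> L;
       dist (v a') (c' s') \<le> L; R \<le> dist x\<^sub>0 (u a)\<rbrakk> \<Longrightarrow> r < l \<and> r < l' \<and> dist (c r) (c' r) < e"
    using geodesics_near_orbit_close[OF r _ e] by metis
  show thesis
  proof
    \<comment> \<open>The orbit point near \<open>\<xi> (R + K)\<close> may lie closer to the origin
      by \<open>K\<close> and must still be at distance at least \<open>R\<close>.\<close>
    show "0 < R + K" using R K by simp
    fix \<xi> \<xi>' :: "real \<Rightarrow> 'x" and \<eta> \<eta>' :: "real \<Rightarrow> 'y"
    assume rays: "geodesic_ray \<xi>" "geodesic_ray \<eta>" "geodesic_ray \<eta>'"
      and 0: "\<xi> 0 = x\<^sub>0" "\<eta> 0 = y\<^sub>0" "\<eta>' 0 = y\<^sub>0"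
      and sh: "shadows A u v K \<xi> \<eta>" "shadows A u v K \<xi>' \<eta>'"
      and close: "dist (\<xi> (R + K)) (\<xi>' (R + K)) \<le> \<delta>"
    have t: "0 \<le> R + K" using R K by simp
    obtain s a where s: "0 \<le> s" "a \<in> A" "dist (u a) (\<xi> (R + K)) \<le> K" "dist (v a) (\<eta> s) \<le> K"
      using shadowsE[OF sh(1) t] .
    obtain s' a' where s': "0 \<le> s'" "a' \<in> A" "dist (u a') (\<xi>' (R + K)) \<le> K"
      "dist (v a') (\<eta>' s') \<le> K"
      using shadowsE[OF sh(2) t] .
    have "dist (u a) (u a') \<le> L"
      using s s' close dist_triangle[of "u a" "u a'" "\<xi> (R + K)"]
        dist_triangle2[of "\<xi> (R + K)" "u a'" "\<xi>' (R + K)"] by (simp add: L_def)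
    moreover have "R \<le> dist x\<^sub>0 (u a)"
      using geodesic_ray_dist[OF rays(1) t] 0 s dist_triangle[of x\<^sub>0 "\<xi> (R + K)" "u a"] by simp
    moreover have "dist (v a) (\<eta> s) \<le> L" "dist (v a') (\<eta>' s') \<le> L"
      using s s' K d by (simp_all add: L_def)
    moreover have "geodesic_path \<eta> s y\<^sub>0 (\<eta> s)" "geodesic_path \<eta>' s' y\<^sub>0 (\<eta>' s')"
      using geodesic_ray_path[OF rays(2) s(1)] geodesic_ray_path[OF rays(3) s'(1)] 0 by simp_all
    ultimately show "dist (\<eta> r) (\<eta>' r) < e" using R(2)[of a a' \<eta> s _ \<eta>' s' _ s s'] s s' by blast
  qed
qed

lemma shadows_asymptotic_image:
  assumes rays: "geodesic_ray \<xi>" "geodesic_ray \<eta>" "geodesic_ray \<eta>'"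
    and 0: "\<xi> 0 = x\<^sub>0" "\<xi>' 0 = x\<^sub>0" "\<eta> 0 = y\<^sub>0" "\<eta>' 0 = y\<^sub>0"
    and sh: "shadows A u v K \<xi> \<eta>" "shadows A u v K \<xi>' \<eta>'" and asym: "(\<xi>, \<xi>') \<in> asymptotic"
  shows "(\<eta>, \<eta>') \<in> asymptotic"
proof (rule asymptoticI[OF rays(2,3)])
  fix t :: real assume t: "0 \<le> t"
  have K: "0 \<le> K" using shadowsE[OF sh(1), of 0] by (metis dist_self order_refl zero_le_dist order_trans)
  have sh': "shadows A u v K \<xi> \<eta>'"
    using sh(2) asymptotic_same_origin[OF X asym] 0 unfolding shadows_def by simp
  obtain R where "0 < R" "\<And>\<xi> \<xi>' \<eta> \<eta>'. \<lbrakk>geodesic_ray \<xi>; geodesic_ray \<eta>; geodesic_ray \<eta>'; \<xi> 0 = x\<^sub>0;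
       \<eta> 0 = y\<^sub>0; \<eta>' 0 = y\<^sub>0; shadows A u v K \<xi> \<eta>; shadows A u v K \<xi>' \<eta>'; dist (\<xi> R) (\<xi>' R) \<le> 0\<rbrakk>
       \<Longrightarrow> dist (\<eta> t) (\<eta>' t) < 1"
    using shadows_close[OF t K order_refl zero_less_one] by metis
  from this(2)[OF rays 0(1,3,4) sh(1) sh'] show "dist (\<eta> t) (\<eta>' t) \<le> 1" by simp
qed

text \<open>The points of \<open>\<eta>\<close> shadowed by \<open>\<xi> 0, \<xi> 1, \<xi> 2, \<dots>\<close> leave every bounded set in jumps of
  bounded length, so they come close to every point of \<open>\<eta>\<close>.\<close>

lemma shadows_converse:
  assumes K: "0 \<le> K"
  obtains L where "\<And>\<xi> \<eta>. \<lbrakk>geodesic_ray \<xi>; geodesic_ray \<eta>; \<xi> 0 = x\<^sub>0; \<eta> 0 = y\<^sub>0; shadows A u v K \<xi> \<eta>\<rbrakk>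
    \<Longrightarrow> shadows A v u L \<eta> \<xi>"
proof -
  obtain C where C: "\<And>a b. \<lbrakk>a \<in> A; b \<in> A; dist (u a) (u b) \<le> 2 * K + 1\<rbrakk> \<Longrightarrow> dist (v a) (v b) \<le> C"
    using dist_v_bound[of "2 * K + 1"] by blast
  obtain B where B: "\<And>a. \<lbrakk>a \<in> A; dist x\<^sub>0 (u a) \<le> K\<rbrakk> \<Longrightarrow> dist y\<^sub>0 (v a) \<le> B"
    using dist_origin_v_bound[of K] by blast
  \<comment> \<open>\<open>J\<close> bounds both the first parameter \<open>s 0\<close> and every
    forward jump. In the choice of \<open>C\<close>, the bound \<open>2 * K + 1\<close> comes from
    consecutive points of \<open>\<xi>\<close> at distance 1, each off its orbit point by
    \<open>K\<close>.\<close>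
  define J where "J = \<bar>B\<bar> + \<bar>C\<bar> + 2 * K"
  show thesis
  proof (rule that[of "K + J"])
    fix \<xi> \<eta>
    assume rays: "geodesic_ray \<xi>" "geodesic_ray \<eta>" and 0: "\<xi> 0 = x\<^sub>0" "\<eta> 0 = y\<^sub>0"
      and sh: "shadows A u v K \<xi> \<eta>"
    have "\<forall>n. \<exists>s a. 0 \<le> s \<and> a \<in> A \<and> dist (u a) (\<xi> (real n)) \<le> K \<and> dist (v a) (\<eta> s) \<le> K"
      using shadowsE[OF sh] of_nat_0_le_iff by metis
    then obtain s a where s: "\<And>n. 0 \<le> s n" and a: "\<And>n. a n \<in> A"
      and ua: "\<And>n. dist (u (a n)) (\<xi> (real n)) \<le> K" and va: "\<And>n. dist (v (a n)) (\<eta> (s n)) \<le> K"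
      by metis
    have start: "s 0 \<le> J"
    proof -
      have "dist y\<^sub>0 (v (a 0)) \<le> B" using B[OF a] ua[of 0] 0 by (simp add: dist_commute)
      then show ?thesis
        using va[of 0] geodesic_ray_dist[OF rays(2) s[of 0]] 0 K
          dist_triangle[of y\<^sub>0 "\<eta> (s 0)" "v (a 0)"] by (simp add: J_def)
    qed
    have step: "s (Suc n) - s n \<le> J" for n
    proof -
      have "dist (\<xi> (real n)) (\<xi> (real (Suc n))) = 1" using rays(1) by (simp add: geodesic_ray_def)
      then have "dist (u (a n)) (u (a (Suc n))) \<le> 2 * K + 1"
        using ua[of n] ua[of "Suc n"] dist_triangle[of "u (a n)" "u (a (Suc n))" "\<xi> (real n)"]
          dist_triangle2[of "\<xi> (real n)" "u (a (Suc n))" "\<xi> (real (Suc n))"] by linarith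
      then have "dist (v (a n)) (v (a (Suc n))) \<le> C" using C a by blast
      moreover have "dist (\<eta> (s n)) (\<eta> (s (Suc n))) = \<bar>s n - s (Suc n)\<bar>"
        using rays(2) s by (simp add: geodesic_ray_def)
      ultimately show ?thesis
        using va[of n] va[of "Suc n"] dist_triangle3[of "\<eta> (s n)" "\<eta> (s (Suc n))" "v (a n)"]
          dist_triangle[of "v (a n)" "\<eta> (s (Suc n))" "v (a (Suc n))"] by (simp add: J_def)
    qed
    have unbounded: "\<exists>n. \<sigma> < s n" for \<sigma>
    proof -
      obtain D where D: "\<And>a. \<lbrakk>a \<in> A; dist y\<^sub>0 (v a) \<le> \<sigma> + K\<rbrakk> \<Longrightarrow> dist x\<^sub>0 (u a) \<le> D"
        using dist_origin_u_bound[of "\<sigma> + K"] by blast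
      obtain n where n: "D + K < real n" using reals_Archimedean2 by blast
      have "D < dist x\<^sub>0 (u (a n))"
        using n ua[of n] geodesic_ray_dist[OF rays(1), of "real n"] 0
          dist_triangle[of x\<^sub>0 "\<xi> (real n)" "u (a n)"] by simp
      then have "\<sigma> + K < dist y\<^sub>0 (v (a n))" using D[OF a[of n]] by fastforce
      moreover have "dist y\<^sub>0 (v (a n)) \<le> s n + K"
        using va[of n] geodesic_ray_dist[OF rays(2) s[of n]] 0
          dist_triangle2[of y\<^sub>0 "v (a n)" "\<eta> (s n)"] by simp
      ultimately show ?thesis by (intro exI[of _ n]) linarith
    qed
    show "shadows A v u (K + J) \<eta> \<xi>"
      unfolding shadows_def
    proof (intro allI impI)
      fix \<sigma> :: real assume \<sigma>: "0 \<le> \<sigma>"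
      \<comment> \<open>At the first passage beyond \<sigma> the preceding parameter is at most
        \<sigma>, so the overshoot is at most one jump; \<open>start\<close> covers a passage at
        index 0.\<close>
      define n where "n = (LEAST n. \<sigma> < s n)"
      have n: "\<sigma> < s n" unfolding n_def using unbounded by (rule LeastI_ex)
      have "s n - \<sigma> \<le> J"
      proof (cases n)
        case (Suc m)
        then have "\<not> \<sigma> < s m" using not_less_Least[of m "\<lambda>n. \<sigma> < s n"] by (simp add: n_def)
        then show ?thesis using step[of m] Suc by simp
      qed (use start \<sigma> in simp)
      moreover have "dist (\<eta> (s n)) (\<eta> \<sigma>) = s n - \<sigma>"
        using rays(2) s \<sigma> n by (simp add: geodesic_ray_def)
      ultimately have "dist (v (a n)) (\<eta> \<sigma>) \<le> K + J"
        using va[of n] dist_triangle[of "v (a n)" "\<eta> \<sigma>" "\<eta> (s n)"] by linarith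
      moreover have "dist (u (a n)) (\<xi> (real n)) \<le> K + J" using ua[of n] K by (simp add: J_def)
      ultimately show "\<exists>t\<ge>0. \<exists>a\<in>A. dist (v a) (\<eta> \<sigma>) \<le> K + J \<and> dist (u a) (\<xi> t) \<le> K + J"
        using a[of n] of_nat_0_le_iff by blast
    qed
  qed
qed

end

section \<open>Consequences of the segment hypothesis\<close>

locale segment_shadows = coarse_orbits +
  fixes N M :: real
  assumes NM: "0 \<le> N" "0 \<le> M"
    and cobounded_u: "\<And>p. \<exists>a\<in>A. dist (u a) p \<le> N"
    and cobounded_v: "\<And>q. \<exists>a\<in>A. dist (v a) q \<le> M"
    and seg_shadow: "\<And>g a. \<lbrakk>g \<in> A; a \<in> A; seg x\<^sub>0 (u g) \<inter> cball (u a) N \<noteq> {}\<rbrakk>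
           \<Longrightarrow> seg y\<^sub>0 (v g) \<inter> cball (v a) M \<noteq> {}"
begin

text \<open>Some orbit point lies within \<open>N\<close> of any given point of the segment in X,
  and the hypothesis carries exactly this orbit point over to Y.\<close>

lemma segment_shadow:
  assumes g: "g \<in> A" and c: "geodesic_path c l x\<^sub>0 (u g)" and e: "geodesic_path e m y\<^sub>0 (v g)"
    and t: "0 \<le> t" "t \<le> l"
  obtains a s where "a \<in> A" "0 \<le> s" "s \<le> m" "dist (u a) (c t) \<le> N" "dist (v a) (e s) \<le> M"
proof -
  obtain a where a: "a \<in> A" "dist (u a) (c t) \<le> N" using cobounded_u by blast
  have "c t \<in> seg x\<^sub>0 (u g) \<inter> cball (u a) N"
    using a t seg_eq_image[OF X c] by (simp add: mem_cball)
  then have "seg y\<^sub>0 (v g) \<inter> cball (v a) M \<noteq> {}" using seg_shadow[OF g a(1)] by blast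
  then obtain s where "0 \<le> s" "s \<le> m" "dist (v a) (e s) \<le> M"
    unfolding seg_eq_image[OF Y e] by (auto simp: mem_cball)
  then show thesis using that a by blast
qed

text \<open>In the bound, \<open>2 * N\<close> separates \<open>\<xi>\<close> from the segment to
  \<open>u (g n)\<close>, another \<open>N\<close> the segment from an orbit point, \<open>M\<close>
  comes from the hypothesis and 1 from passing to the limit. It does not depend on
  \<open>\<xi>\<close>.\<close>

lemma shadowing_ray_exists:
  assumes \<xi>: "geodesic_ray \<xi>" "\<xi> 0 = x\<^sub>0"
  obtains \<eta> where "geodesic_ray \<eta>" "\<eta> 0 = y\<^sub>0" "shadows A u v (3 * N + M + 1) \<xi> \<eta>"
proof -
  have "\<forall>n. \<exists>g. g \<in> A \<and> dist (u g) (\<xi> (real n)) \<le> N" using cobounded_u by blast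
  then obtain g where g: "\<And>n. g n \<in> A" "\<And>n. dist (u (g n)) (\<xi> (real n)) \<le> N" by metis
  define l m where "l n = dist x\<^sub>0 (u (g n))" and "m n = dist y\<^sub>0 (v (g n))" for n
  obtain c where c: "\<And>n. geodesic_path (c n) (l n) x\<^sub>0 (u (g n))"
    unfolding l_def by (rule geodesic_paths_exist[OF X, of x\<^sub>0 "\<lambda>n. u (g n)"]) blast
  obtain e where e: "\<And>n. geodesic_path (e n) (m n) y\<^sub>0 (v (g n))"
    unfolding m_def by (rule geodesic_paths_exist[OF Y, of y\<^sub>0 "\<lambda>n. v (g n)"]) blast
  have l: "real n - N \<le> l n" for n
    using g(2)[of n] geodesic_ray_dist[OF \<xi>(1), of "real n"] \<xi>(2)
      dist_triangle[of x\<^sub>0 "\<xi> (real n)" "u (g n)"] by (simp add: l_def)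
  \<comment> \<open>Orbit points that leave every bounded set of X also leave every bounded set of
    Y.\<close>
  have "filterlim m at_top sequentially"
    unfolding filterlim_at_top
  proof
    fix Z
    obtain D where D: "\<And>a. \<lbrakk>a \<in> A; dist y\<^sub>0 (v a) \<le> Z\<rbrakk> \<Longrightarrow> dist x\<^sub>0 (u a) \<le> D"
      using dist_origin_u_bound[of Z] by blast
    have "\<forall>\<^sub>F n in sequentially. D + 1 \<le> l n"
      using filterlim_ge_shift[OF l] unfolding filterlim_at_top by blast
    then show "\<forall>\<^sub>F n in sequentially. Z \<le> m n"
    proof (rule eventually_mono)
      fix n assume "D + 1 \<le> l n"
      then show "Z \<le> m n" using D[OF g(1)[of n]] by (fastforce simp: l_def m_def)
    qed
  qed
  then obtain \<eta> where \<eta>: "geodesic_ray \<eta>" "\<eta> 0 = y\<^sub>0"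
    and lim: "\<And>R \<epsilon> n0. \<lbrakk>0 \<le> R; 0 < \<epsilon>\<rbrakk> \<Longrightarrow> \<exists>n\<ge>n0. R \<le> m n \<and> dist (e n R) (\<eta> R) < \<epsilon>"
    using limit_ray[of e m y\<^sub>0 "\<lambda>n. v (g n)"] e Y unfolding CAT0_space_def by metis
  have "shadows A u v (3 * N + M + 1) \<xi> \<eta>"
    unfolding shadows_def
  proof (intro allI impI)
    fix t :: real assume t: "0 \<le> t"
    obtain C where C: "\<And>a. \<lbrakk>a \<in> A; dist x\<^sub>0 (u a) \<le> t + N\<rbrakk> \<Longrightarrow> dist y\<^sub>0 (v a) \<le> C"
      using dist_origin_v_bound[of "t + N"] by blast
    \<comment> \<open>The parameter \<open>s\<close> found below depends on \<open>n\<close>, while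
      \<open>n\<close> has to be chosen first. \<open>B\<close> bounds \<open>s\<close> in advance,
      and closeness of \<open>e n\<close> to \<open>\<eta>\<close> at \<open>B\<close> implies
      closeness at \<open>s\<close>.\<close>
    define B where "B = \<bar>C\<bar> + M"
    have B0: "0 \<le> B" using NM by (simp add: B_def)
    obtain n0 where n0: "t + N + 1 < real n0" using reals_Archimedean2 by blast
    obtain n where n: "n \<ge> n0" "B \<le> m n" "dist (e n B) (\<eta> B) < 1" using lim[OF B0] zero_less_one by blast
    have tn: "t + N + 1 < real n" using n0 n(1) by linarith
    then have tl: "t \<le> l n" using l[of n] by linarith
    have "dist (\<xi> t) (c n t) \<le> 2 * N"
    proof (rule geodesics_close_initial(3)[OF X _ c[of n], of \<xi> "real n" _ "real n" "l n"])
      show "geodesic_path \<xi> (real n) x\<^sub>0 (\<xi> (real n))" using geodesic_ray_path[OF \<xi>(1)] \<xi>(2) by fastforce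
      show "dist (\<xi> (real n)) (c n (l n)) \<le> N"
        using g(2)[of n] c[of n] by (simp add: geodesic_path_def dist_commute)
    qed (use tn t tl NM in auto)
    moreover obtain a s where a: "a \<in> A" "0 \<le> s" "s \<le> m n" "dist (u a) (c n t) \<le> N"
      "dist (v a) (e n s) \<le> M"
      using segment_shadow[OF g(1) c e t tl] .
    ultimately have 1: "dist (u a) (\<xi> t) \<le> 3 * N"
      using dist_triangle2[of "u a" "\<xi> t" "c n t"] by linarith
    have "dist x\<^sub>0 (u a) \<le> t + N"
      using geodesic_path_dist[OF c t tl] a(4) dist_triangle2[of x\<^sub>0 "u a" "c n t"] by linarith
    then have "s \<le> B"
      using C[OF a(1)] geodesic_path_dist[OF e a(2,3)] a(5) dist_triangle[of y\<^sub>0 "e n s" "v a"]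
      by (simp add: B_def)
    then have "dist (e n s) (\<eta> s) \<le> dist (e n B) (\<eta> B)"
      using geodesics_diverge_le[OF Y e geodesic_ray_path[OF \<eta>(1) B0, unfolded \<eta>(2)] a(2)] n by simp
    then have "dist (v a) (\<eta> s) \<le> M + 1"
      using n(3) a(5) dist_triangle[of "v a" "\<eta> s" "e n s"] by linarith
    then show "\<exists>s\<ge>0. \<exists>a\<in>A. dist (u a) (\<xi> t) \<le> 3 * N + M + 1 \<and> dist (v a) (\<eta> s) \<le> 3 * N + M + 1"
      using 1 a NM by (intro exI[of _ s] conjI bexI[of _ a]) auto
  qed
  then show thesis using that \<eta> by blast
qed

text \<open>A single orbit segment is controlled at a single radius. This serves both the
  surjectivity of the correspondence and the continuous extension.\<close>

lemma segments_converge: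
  assumes r: "0 \<le> r" and K: "0 \<le> K" and d: "0 \<le> \<delta>" and e: "0 < \<epsilon>"
  obtains R where "0 < R"
    "\<And>\<xi> \<eta> g c l e m. \<lbrakk>geodesic_ray \<xi>; geodesic_ray \<eta>; \<xi> 0 = x\<^sub>0; \<eta> 0 = y\<^sub>0; shadows A u v K \<xi> \<eta>;
       g \<in> A; geodesic_path c l x\<^sub>0 (u g); geodesic_path e m y\<^sub>0 (v g); R \<le> l;
       dist (\<xi> R) (c R) \<le> \<delta>\<rbrakk> \<Longrightarrow> r < m \<and> dist (\<eta> r) (e r) < \<epsilon>"
proof -
  \<comment> \<open>\<open>K + \<delta> + N\<close> joins the two orbit points via
    \<open>\<xi>\<close> and \<open>c\<close>; \<open>K\<close> and \<open>M\<close> are the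
    distances to \<open>\<eta>\<close> and \<open>e\<close>.\<close>
  define L where "L = K + N + M + \<delta>"
  have "0 \<le> L" using K d NM by (simp add: L_def)
  then obtain R where R: "0 < R"
    "\<And>a a' c c' l l' y y' s s'. \<lbrakk>a \<in> A; a' \<in> A; geodesic_path c l y\<^sub>0 y; geodesic_path c' l' y\<^sub>0 y';
       0 \<le> s; s \<le> l; 0 \<le> s'; s' \<le> l'; dist (u a) (u a') \<le> L; dist (v a) (c s) \<le> L;
       dist (v a') (c' s') \<le> L; R \<le> dist x\<^sub>0 (u a)\<rbrakk> \<Longrightarrow> r < l \<and> r < l' \<and> dist (c r) (c' r) < \<epsilon>"
    using geodesics_near_orbit_close[OF r _ e] by metis
  show thesis
  proof
    show "0 < R + K" using R K by simp
    fix \<xi> \<eta> g c l e m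
    assume rays: "geodesic_ray \<xi>" "geodesic_ray \<eta>" and 0: "\<xi> 0 = x\<^sub>0" "\<eta> 0 = y\<^sub>0"
      and sh: "shadows A u v K \<xi> \<eta>" and g: "g \<in> A"
      and c: "geodesic_path c l x\<^sub>0 (u g)" and e: "geodesic_path e m y\<^sub>0 (v g)"
      and Rl: "R + K \<le> l" and close: "dist (\<xi> (R + K)) (c (R + K)) \<le> \<delta>"
    have t: "0 \<le> R + K" using R K by simp
    obtain s a where s: "0 \<le> s" "a \<in> A" "dist (u a) (\<xi> (R + K)) \<le> K" "dist (v a) (\<eta> s) \<le> K"
      using shadowsE[OF sh t] .
    obtain a' s' where s': "a' \<in> A" "0 \<le> s'" "s' \<le> m" "dist (u a') (c (R + K)) \<le> N"
      "dist (v a') (e s') \<le> M"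
      using segment_shadow[OF g c e t Rl] .
    have "dist (u a) (u a') \<le> L"
      using s s' close dist_triangle[of "u a" "u a'" "\<xi> (R + K)"] NM
        dist_triangle2[of "\<xi> (R + K)" "u a'" "c (R + K)"] by (simp add: L_def)
    moreover have "R \<le> dist x\<^sub>0 (u a)"
      using geodesic_ray_dist[OF rays(1) t] 0 s dist_triangle[of x\<^sub>0 "\<xi> (R + K)" "u a"] by simp
    moreover have "dist (v a) (\<eta> s) \<le> L" "dist (v a') (e s') \<le> L"
      using s s' K d NM by (simp_all add: L_def)
    moreover have "geodesic_path \<eta> s y\<^sub>0 (\<eta> s)"
      using geodesic_ray_path[OF rays(2) s(1)] 0 by simp
    ultimately show "r < m \<and> dist (\<eta> r) (e r) < \<epsilon>" using R(2)[of a a' \<eta> s _ e m _ s s'] s s' e by blast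
  qed
qed

text \<open>The hypothesis cannot be reversed, so the limit ray \<open>\<xi>\<close> is first given
  some shadowing ray \<open>\<eta>'\<close>. For suitable \<open>n\<close>, the segment to
  \<open>v (h n)\<close> follows \<open>\<eta>'\<close> by \<open>segments_converge\<close> and
  \<open>\<eta>\<close> by the choice of \<open>h\<close>. The gap is bounded by
  \<open>2 * M + 1\<close> at all parameters, and the common origin forces the two rays to
  agree.\<close>

lemma shadowed_ray_exists:
  assumes \<eta>: "geodesic_ray \<eta>" "\<eta> 0 = y\<^sub>0"
  obtains \<xi> where "geodesic_ray \<xi>" "\<xi> 0 = x\<^sub>0" "shadows A u v (3 * N + M + 1) \<xi> \<eta>"
proof -
  have "\<forall>n. \<exists>h. h \<in> A \<and> dist (v h) (\<eta> (real n)) \<le> M" using cobounded_v by blast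
  then obtain h where h: "\<And>n. h n \<in> A" "\<And>n. dist (v (h n)) (\<eta> (real n)) \<le> M" by metis
  define l m where "l n = dist x\<^sub>0 (u (h n))" and "m n = dist y\<^sub>0 (v (h n))" for n
  obtain c where c: "\<And>n. geodesic_path (c n) (l n) x\<^sub>0 (u (h n))"
    unfolding l_def by (rule geodesic_paths_exist[OF X, of x\<^sub>0 "\<lambda>n. u (h n)"]) blast
  obtain e where e: "\<And>n. geodesic_path (e n) (m n) y\<^sub>0 (v (h n))"
    unfolding m_def by (rule geodesic_paths_exist[OF Y, of y\<^sub>0 "\<lambda>n. v (h n)"]) blast
  have m: "real n - M \<le> m n" for n
    using h(2)[of n] geodesic_ray_dist[OF \<eta>(1), of "real n"] \<eta>(2)
      dist_triangle[of y\<^sub>0 "\<eta> (real n)" "v (h n)"] by (simp add: m_def)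
  have "filterlim l at_top sequentially"
    unfolding filterlim_at_top
  proof
    fix Z
    obtain D where D: "\<And>a. \<lbrakk>a \<in> A; dist x\<^sub>0 (u a) \<le> Z\<rbrakk> \<Longrightarrow> dist y\<^sub>0 (v a) \<le> D"
      using dist_origin_v_bound[of Z] by blast
    have "\<forall>\<^sub>F n in sequentially. D + 1 \<le> m n"
      using filterlim_ge_shift[OF m] unfolding filterlim_at_top by blast
    then show "\<forall>\<^sub>F n in sequentially. Z \<le> l n"
    proof (rule eventually_mono)
      fix n assume "D + 1 \<le> m n"
      then show "Z \<le> l n" using D[OF h(1)[of n]] by (fastforce simp: l_def m_def)
    qed
  qed
  then obtain \<xi> where \<xi>: "geodesic_ray \<xi>" "\<xi> 0 = x\<^sub>0"
    and lim: "\<And>R \<epsilon> n0. \<lbrakk>0 \<le> R; 0 < \<epsilon>\<rbrakk> \<Longrightarrow> \<exists>n\<ge>n0. R \<le> l n \<and> dist (c n R) (\<xi> R) < \<epsilon>"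
    using limit_ray[of c l x\<^sub>0 "\<lambda>n. u (h n)"] c X unfolding CAT0_space_def by metis
  let ?K = "3 * N + M + 1"
  have K: "0 \<le> ?K" using NM by simp
  obtain \<eta>' where \<eta>': "geodesic_ray \<eta>'" "\<eta>' 0 = y\<^sub>0" and sh: "shadows A u v ?K \<xi> \<eta>'"
    using shadowing_ray_exists[OF \<xi>] .
  have "(\<eta>', \<eta>) \<in> asymptotic"
  proof (rule asymptoticI[OF \<eta>'(1) \<eta>(1)])
    fix t :: real assume t: "0 \<le> t"
    obtain R where R: "0 < R"
      "\<And>\<xi> \<eta> g c l e m. \<lbrakk>geodesic_ray \<xi>; geodesic_ray \<eta>; \<xi> 0 = x\<^sub>0; \<eta> 0 = y\<^sub>0; shadows A u v ?K \<xi> \<eta>;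
       g \<in> A; geodesic_path c l x\<^sub>0 (u g); geodesic_path e m y\<^sub>0 (v g); R \<le> l;
       dist (\<xi> R) (c R) \<le> 1\<rbrakk> \<Longrightarrow> t < m \<and> dist (\<eta> t) (e t) < 1"
      using segments_converge[OF t K zero_le_one zero_less_one] by metis
    obtain n0 where n0: "t + M + 1 < real n0" using reals_Archimedean2 by blast
    obtain n where n: "n \<ge> n0" "R \<le> l n" "dist (c n R) (\<xi> R) < 1"
      using lim[of R 1 n0] R by auto
    have 1: "t < m n \<and> dist (\<eta>' t) (e n t) < 1"
      using R(2)[OF \<xi>(1) \<eta>'(1) \<xi>(2) \<eta>'(2) sh h(1) c e n(2)] n(3) by (simp add: dist_commute)
    have tn: "t + M + 1 < real n" using n0 n(1) by linarith
    have "dist (\<eta> t) (e n t) \<le> 2 * M"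
    proof (rule geodesics_close_initial(3)[OF Y _ e[of n], of \<eta> "real n" _ "real n" "m n"])
      show "geodesic_path \<eta> (real n) y\<^sub>0 (\<eta> (real n))" using geodesic_ray_path[OF \<eta>(1)] \<eta>(2) by fastforce
      show "dist (\<eta> (real n)) (e n (m n)) \<le> M"
        using h(2)[of n] e[of n] by (simp add: geodesic_path_def dist_commute)
    qed (use tn t m[of n] NM in \<open>auto simp: m_def\<close>)
    then show "dist (\<eta>' t) (\<eta> t) \<le> 2 * M + 1"
      using 1 dist_triangle2[of "\<eta>' t" "\<eta> t" "e n t"] by linarith
  qed
  then have "shadows A u v ?K \<xi> \<eta>"
    using sh asymptotic_same_origin[OF Y] \<eta>(2) \<eta>'(2) unfolding shadows_def by fastforce
  then show thesis using that \<xi> by blast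
qed

end


section \<open>The boundary correspondence\<close>

lemma shadows_cong:
  assumes "\<And>t. 0 \<le> t \<Longrightarrow> \<xi> t = \<xi>' t" "\<And>t. 0 \<le> t \<Longrightarrow> \<eta> t = \<eta>' t"
  shows "shadows A u v K \<xi> \<eta> \<longleftrightarrow> shadows A u v K \<xi>' \<eta>'"
  using assms unfolding shadows_def by (metis (no_types))

text \<open>Representatives issuing from the base point differ only at negative parameters, so
  quantifying over all of them amounts to testing one.\<close>

definition boundary_shadows ::
  "'g set \<Rightarrow> ('g \<Rightarrow> 'a::metric_space) \<Rightarrow> ('g \<Rightarrow> 'b::metric_space) \<Rightarrow> 'a \<Rightarrow> 'b \<Rightarrow> real \<Rightarrow>
   (real \<Rightarrow> 'a) set \<Rightarrow> (real \<Rightarrow> 'b) set \<Rightarrow> bool" where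
  "boundary_shadows A u v x\<^sub>0 y\<^sub>0 K \<alpha> \<beta> \<longleftrightarrow>
     (\<forall>\<xi>\<in>\<alpha>. \<forall>\<eta>\<in>\<beta>. \<xi> 0 = x\<^sub>0 \<longrightarrow> \<eta> 0 = y\<^sub>0 \<longrightarrow> shadows A u v K \<xi> \<eta>)"

lemma boundary_shadowsD:
  assumes "boundary_shadows A u v x\<^sub>0 y\<^sub>0 K \<alpha> \<beta>" "\<xi> \<in> \<alpha>" "\<eta> \<in> \<beta>" "\<xi> 0 = x\<^sub>0" "\<eta> 0 = y\<^sub>0"
  shows "shadows A u v K \<xi> \<eta>"
  using assms unfolding boundary_shadows_def by blast

context coarse_orbits
begin

lemma boundary_shadowsI:
  assumes \<alpha>: "\<alpha> \<in> boundary" "\<xi> \<in> \<alpha>" "\<xi> 0 = x\<^sub>0" and \<beta>: "\<beta> \<in> boundary" "\<eta> \<in> \<beta>" "\<eta> 0 = y\<^sub>0"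
    and sh: "shadows A u v K \<xi> \<eta>"
  shows "boundary_shadows A u v x\<^sub>0 y\<^sub>0 K \<alpha> \<beta>"
  unfolding boundary_shadows_def
proof (intro ballI impI)
  fix \<xi>' \<eta>' assume *: "\<xi>' \<in> \<alpha>" "\<eta>' \<in> \<beta>" "\<xi>' 0 = x\<^sub>0" "\<eta>' 0 = y\<^sub>0"
  have "\<xi> t = \<xi>' t" "\<eta> t = \<eta>' t" if "0 \<le> t" for t
    using asymptotic_same_origin[OF X boundary_asymptotic[OF \<alpha>(1,2) *(1)]]
      asymptotic_same_origin[OF Y boundary_asymptotic[OF \<beta>(1,2) *(2)]] \<alpha> \<beta> * that by simp_all
  then show "shadows A u v K \<xi>' \<eta>'" using sh shadows_cong[of \<xi> \<xi>' \<eta> \<eta>'] by blast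
qed

lemma boundary_shadows_unique:
  assumes \<alpha>: "\<alpha> \<in> boundary" and \<beta>: "\<beta> \<in> boundary" "\<beta>' \<in> boundary"
    and sh: "boundary_shadows A u v x\<^sub>0 y\<^sub>0 K \<alpha> \<beta>" "boundary_shadows A u v x\<^sub>0 y\<^sub>0 L \<alpha> \<beta>'"
  shows "\<beta> = \<beta>'"
proof -
  obtain \<xi> where \<xi>: "\<xi> \<in> \<alpha>" "\<xi> 0 = x\<^sub>0" "geodesic_ray \<xi>" using boundary_ray_from[OF X \<alpha>] .
  obtain \<eta> where \<eta>: "\<eta> \<in> \<beta>" "\<eta> 0 = y\<^sub>0" "geodesic_ray \<eta>" using boundary_ray_from[OF Y \<beta>(1)] .
  obtain \<eta>' where \<eta>': "\<eta>' \<in> \<beta>'" "\<eta>' 0 = y\<^sub>0" "geodesic_ray \<eta>'" using boundary_ray_from[OF Y \<beta>(2)] .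
  have "shadows A u v (max K L) \<xi> \<eta>" "shadows A u v (max K L) \<xi> \<eta>'"
    using boundary_shadowsD[OF sh(1) \<xi>(1) \<eta>(1) \<xi>(2) \<eta>(2)]
      boundary_shadowsD[OF sh(2) \<xi>(1) \<eta>'(1) \<xi>(2) \<eta>'(2)] by (auto elim: shadows_mono)
  then have "(\<eta>, \<eta>') \<in> asymptotic"
    using shadows_asymptotic_image[where \<xi>' = \<xi>, OF \<xi>(3) \<eta>(3) \<eta>'(3) \<xi>(2,2) \<eta>(2) \<eta>'(2)]
      boundary_asymptotic[OF \<alpha> \<xi>(1,1)] by blast
  then show ?thesis using boundary_eqI[OF \<beta> \<eta>(1) \<eta>'(1)] by blast
qed

lemma cone_nbhd_shadow:
  assumes r: "0 < r" and K: "0 \<le> K" and e: "0 < \<epsilon>"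
  obtains R where "0 < R"
    "\<And>\<alpha> \<alpha>' \<beta> \<beta>'. \<lbrakk>\<alpha> \<in> boundary; \<alpha>' \<in> boundary; \<beta> \<in> boundary; \<beta>' \<in> boundary;
       boundary_shadows A u v x\<^sub>0 y\<^sub>0 K \<alpha> \<beta>; boundary_shadows A u v x\<^sub>0 y\<^sub>0 K \<alpha>' \<beta>';
       Inr \<alpha>' \<in> cone_nbhd x\<^sub>0 \<epsilon> \<alpha> R\<rbrakk> \<Longrightarrow> Inr \<beta>' \<in> cone_nbhd y\<^sub>0 \<epsilon> \<beta> r"
proof -
  obtain R where R: "0 < R"
    "\<And>\<xi> \<xi>' \<eta> \<eta>'. \<lbrakk>geodesic_ray \<xi>; geodesic_ray \<eta>; geodesic_ray \<eta>'; \<xi> 0 = x\<^sub>0; \<eta> 0 = y\<^sub>0; \<eta>' 0 = y\<^sub>0;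
       shadows A u v K \<xi> \<eta>; shadows A u v K \<xi>' \<eta>'; dist (\<xi> R) (\<xi>' R) \<le> \<epsilon>\<rbrakk>
       \<Longrightarrow> dist (\<eta> r) (\<eta>' r) < \<epsilon>"
    using shadows_close[OF less_imp_le[OF r] K less_imp_le[OF e] e] by metis
  show thesis
  proof
    show "0 < R" by fact
    fix \<alpha> \<alpha>' :: "(real \<Rightarrow> 'x) set" and \<beta> \<beta>' :: "(real \<Rightarrow> 'y) set"
    assume bd: "\<alpha> \<in> boundary" "\<alpha>' \<in> boundary" "\<beta> \<in> boundary" "\<beta>' \<in> boundary"
      and sh: "boundary_shadows A u v x\<^sub>0 y\<^sub>0 K \<alpha> \<beta>" "boundary_shadows A u v x\<^sub>0 y\<^sub>0 K \<alpha>' \<beta>'"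
      and near: "Inr \<alpha>' \<in> cone_nbhd x\<^sub>0 \<epsilon> \<alpha> R"
    obtain \<xi> where \<xi>: "\<xi> \<in> \<alpha>" "\<xi> 0 = x\<^sub>0" "geodesic_ray \<xi>" using boundary_ray_from[OF X bd(1)] .
    obtain \<xi>' where \<xi>': "\<xi>' \<in> \<alpha>'" "\<xi>' 0 = x\<^sub>0" "geodesic_ray \<xi>'" using boundary_ray_from[OF X bd(2)] .
    obtain \<eta> where \<eta>: "\<eta> \<in> \<beta>" "\<eta> 0 = y\<^sub>0" "geodesic_ray \<eta>" using boundary_ray_from[OF Y bd(3)] .
    obtain \<eta>' where \<eta>': "\<eta>' \<in> \<beta>'" "\<eta>' 0 = y\<^sub>0" "geodesic_ray \<eta>'" using boundary_ray_from[OF Y bd(4)] .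
    have "dist (\<xi> R) (\<xi>' R) < \<epsilon>"
      using near cone_nbhd_Inr_iff[OF X bd(1) \<xi>(1,2) bd(2) \<xi>'(1,2)] R(1) by simp
    then have "dist (\<eta> r) (\<eta>' r) < \<epsilon>"
      using R(2)[OF \<xi>(3) \<eta>(3) \<eta>'(3) \<xi>(2) \<eta>(2) \<eta>'(2)
          boundary_shadowsD[OF sh(1) \<xi>(1) \<eta>(1) \<xi>(2) \<eta>(2)]
          boundary_shadowsD[OF sh(2) \<xi>'(1) \<eta>'(1) \<xi>'(2) \<eta>'(2)]] by simp
    then show "Inr \<beta>' \<in> cone_nbhd y\<^sub>0 \<epsilon> \<beta> r"
      using cone_nbhd_Inr_iff[OF Y bd(3) \<eta>(1,2) bd(4) \<eta>'(1,2)] r by simp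
  qed
qed

lemma continuous_map_shadow:
  assumes K: "0 \<le> K" and e: "0 < \<epsilon>" and \<phi>: "\<And>\<alpha>. \<alpha> \<in> boundary \<Longrightarrow> \<phi> \<alpha> \<in> boundary"
    and sh: "\<And>\<alpha>. \<alpha> \<in> boundary \<Longrightarrow> boundary_shadows A u v x\<^sub>0 y\<^sub>0 K \<alpha> (\<phi> \<alpha>)"
  shows "continuous_map (boundary_topology x\<^sub>0 \<epsilon>) (boundary_topology y\<^sub>0 \<epsilon>) \<phi>"
  unfolding continuous_map_def topspace_boundary_topology[OF X] topspace_boundary_topology[OF Y]
proof (intro conjI allI impI)
  show "\<phi> \<in> boundary \<rightarrow> boundary" using \<phi> by blast
  fix U assume "openin (boundary_topology y\<^sub>0 \<epsilon>) U"
  then have U: "\<And>\<beta>. \<beta> \<in> U \<Longrightarrow> \<exists>r>0. \<forall>\<beta>'\<in>boundary. Inr \<beta>' \<in> cone_nbhd y\<^sub>0 \<epsilon> \<beta> r \<longrightarrow> \<beta>' \<in> U"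
    unfolding openin_boundary_topology_iff[OF Y e] by blast
  show "openin (boundary_topology x\<^sub>0 \<epsilon>) {\<alpha> \<in> boundary. \<phi> \<alpha> \<in> U}"
    unfolding openin_boundary_topology_iff[OF X e]
  proof (intro conjI ballI)
    show "{\<alpha> \<in> boundary. \<phi> \<alpha> \<in> U} \<subseteq> boundary" by blast
    fix \<alpha> assume "\<alpha> \<in> {\<alpha> \<in> boundary. \<phi> \<alpha> \<in> U}"
    then have \<alpha>: "\<alpha> \<in> boundary" "\<phi> \<alpha> \<in> U" by simp_all
    obtain r where r: "0 < r" "\<And>\<beta>'. \<lbrakk>\<beta>' \<in> boundary; Inr \<beta>' \<in> cone_nbhd y\<^sub>0 \<epsilon> (\<phi> \<alpha>) r\<rbrakk> \<Longrightarrow> \<beta>' \<in> U"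
      using U[OF \<alpha>(2)] by blast
    obtain R where R: "0 < R"
      "\<And>\<alpha> \<alpha>' \<beta> \<beta>'. \<lbrakk>\<alpha> \<in> boundary; \<alpha>' \<in> boundary; \<beta> \<in> boundary; \<beta>' \<in> boundary;
       boundary_shadows A u v x\<^sub>0 y\<^sub>0 K \<alpha> \<beta>; boundary_shadows A u v x\<^sub>0 y\<^sub>0 K \<alpha>' \<beta>';
       Inr \<alpha>' \<in> cone_nbhd x\<^sub>0 \<epsilon> \<alpha> R\<rbrakk> \<Longrightarrow> Inr \<beta>' \<in> cone_nbhd y\<^sub>0 \<epsilon> \<beta> r"
      using cone_nbhd_shadow[OF r(1) K e] by metis
    have "\<alpha>' \<in> {\<alpha> \<in> boundary. \<phi> \<alpha> \<in> U}"
      if "\<alpha>' \<in> boundary" "Inr \<alpha>' \<in> cone_nbhd x\<^sub>0 \<epsilon> \<alpha> R" for \<alpha>'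
      using R(2)[OF \<alpha>(1) that(1) \<phi>[OF \<alpha>(1)] \<phi>[OF that(1)] sh[OF \<alpha>(1)] sh[OF that(1)] that(2)]
        r(2) \<phi> that(1) by simp
    then show "\<exists>r>0. \<forall>\<beta>\<in>boundary. Inr \<beta> \<in> cone_nbhd x\<^sub>0 \<epsilon> \<alpha> r \<longrightarrow> \<beta> \<in> {\<alpha> \<in> boundary. \<phi> \<alpha> \<in> U}"
      using R(1) by blast
  qed
qed

end

section \<open>The homeomorphism and its extension property\<close>

context segment_shadows
begin

lemma boundary_homeomorphism:
  obtains K \<phi> where "0 \<le> K" "\<And>\<alpha>. \<alpha> \<in> boundary \<Longrightarrow> \<phi> \<alpha> \<in> boundary"
    "\<And>\<alpha>. \<alpha> \<in> boundary \<Longrightarrow> boundary_shadows A u v x\<^sub>0 y\<^sub>0 K \<alpha> (\<phi> \<alpha>)"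
    "\<And>\<epsilon>. 0 < \<epsilon> \<Longrightarrow> homeomorphic_map (boundary_topology x\<^sub>0 \<epsilon>) (boundary_topology y\<^sub>0 \<epsilon>) \<phi>"
proof -
  interpret swap: coarse_orbits A v u y\<^sub>0 x\<^sub>0 by (rule swapped)
  define K\<^sub>0 where "K\<^sub>0 = 3 * N + M + 1"
  have "0 \<le> K\<^sub>0" using NM by (simp add: K\<^sub>0_def)
  then obtain L where L: "\<And>\<xi> \<eta>. \<lbrakk>geodesic_ray \<xi>; geodesic_ray \<eta>; \<xi> 0 = x\<^sub>0; \<eta> 0 = y\<^sub>0;
      shadows A u v K\<^sub>0 \<xi> \<eta>\<rbrakk> \<Longrightarrow> shadows A v u L \<eta> \<xi>"
    using shadows_converse by metis
  define K where "K = max K\<^sub>0 L"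
  have K: "0 \<le> K" using \<open>0 \<le> K\<^sub>0\<close> by (simp add: K_def)
  \<comment> \<open>Both directions are recorded under one bound, so that uniqueness and continuity
    apply equally to the swapped spaces and hence to the inverse.\<close>
  define rel where "rel \<alpha> \<beta> \<longleftrightarrow> boundary_shadows A u v x\<^sub>0 y\<^sub>0 K \<alpha> \<beta> \<and>
    boundary_shadows A v u y\<^sub>0 x\<^sub>0 K \<beta> \<alpha>" for \<alpha> \<beta>
  have relI: "rel \<alpha> \<beta>" if \<alpha>: "\<alpha> \<in> boundary" "\<xi> \<in> \<alpha>" "\<xi> 0 = x\<^sub>0"
    and \<beta>: "\<beta> \<in> boundary" "\<eta> \<in> \<beta>" "\<eta> 0 = y\<^sub>0" and sh: "shadows A u v K\<^sub>0 \<xi> \<eta>" for \<alpha> \<beta> \<xi> \<eta>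
  proof -
    have "shadows A v u L \<eta> \<xi>"
      using L[OF boundary_ray[OF \<alpha>(1,2)] boundary_ray[OF \<beta>(1,2)] \<alpha>(3) \<beta>(3) sh] .
    then have "shadows A u v K \<xi> \<eta>" "shadows A v u K \<eta> \<xi>"
      using sh unfolding K_def by (auto elim: shadows_mono)
    then show ?thesis
      unfolding rel_def using boundary_shadowsI[OF \<alpha> \<beta>] swap.boundary_shadowsI[OF \<beta> \<alpha>] by blast
  qed
  have "\<exists>\<beta>. \<beta> \<in> boundary \<and> rel \<alpha> \<beta>" if \<alpha>: "\<alpha> \<in> boundary" for \<alpha>
  proof -
    obtain \<xi> where \<xi>: "\<xi> \<in> \<alpha>" "\<xi> 0 = x\<^sub>0" "geodesic_ray \<xi>" using boundary_ray_from[OF X \<alpha>] .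
    obtain \<eta> where \<eta>: "geodesic_ray \<eta>" "\<eta> 0 = y\<^sub>0" "shadows A u v K\<^sub>0 \<xi> \<eta>"
      using shadowing_ray_exists[OF \<xi>(3,2)] unfolding K\<^sub>0_def .
    show ?thesis using relI[OF \<alpha> \<xi>(1,2) asymptotic_class[OF \<eta>(1)] \<eta>(2,3)] asymptotic_class[OF \<eta>(1)] by blast
  qed
  then obtain \<phi> where \<phi>: "\<And>\<alpha>. \<alpha> \<in> boundary \<Longrightarrow> \<phi> \<alpha> \<in> boundary" "\<And>\<alpha>. \<alpha> \<in> boundary \<Longrightarrow> rel \<alpha> (\<phi> \<alpha>)"
    by metis
  have "\<exists>\<alpha>. \<alpha> \<in> boundary \<and> rel \<alpha> \<beta>" if \<beta>: "\<beta> \<in> boundary" for \<beta>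
  proof -
    obtain \<eta> where \<eta>: "\<eta> \<in> \<beta>" "\<eta> 0 = y\<^sub>0" "geodesic_ray \<eta>" using boundary_ray_from[OF Y \<beta>] .
    obtain \<xi> where \<xi>: "geodesic_ray \<xi>" "\<xi> 0 = x\<^sub>0" "shadows A u v K\<^sub>0 \<xi> \<eta>"
      using shadowed_ray_exists[OF \<eta>(3,2)] unfolding K\<^sub>0_def .
    show ?thesis using relI[OF asymptotic_class[OF \<xi>(1)] \<xi>(2) \<beta> \<eta>(1,2) \<xi>(3)] asymptotic_class[OF \<xi>(1)] by blast
  qed
  then obtain \<psi> where \<psi>: "\<And>\<beta>. \<beta> \<in> boundary \<Longrightarrow> \<psi> \<beta> \<in> boundary" "\<And>\<beta>. \<beta> \<in> boundary \<Longrightarrow> rel (\<psi> \<beta>) \<beta>"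
    by metis
  \<comment> \<open>Both sides correspond to \<open>\<psi> \<beta>\<close>; uniqueness identifies
    them.\<close>
  have inverse: "\<phi> (\<psi> \<beta>) = \<beta>" if \<beta>: "\<beta> \<in> boundary" for \<beta>
    using boundary_shadows_unique[OF \<psi>(1)[OF \<beta>] \<phi>(1)[OF \<psi>(1)[OF \<beta>]] \<beta>]
      \<phi>(2)[OF \<psi>(1)[OF \<beta>]] \<psi>(2)[OF \<beta>] unfolding rel_def by blast
  have inverse': "\<psi> (\<phi> \<alpha>) = \<alpha>" if \<alpha>: "\<alpha> \<in> boundary" for \<alpha>
    using swap.boundary_shadows_unique[OF \<phi>(1)[OF \<alpha>] \<psi>(1)[OF \<phi>(1)[OF \<alpha>]] \<alpha>]
      \<phi>(2)[OF \<alpha>] \<psi>(2)[OF \<phi>(1)[OF \<alpha>]] unfolding rel_def by blast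
  have "homeomorphic_map (boundary_topology x\<^sub>0 \<epsilon>) (boundary_topology y\<^sub>0 \<epsilon>) \<phi>" if e: "0 < \<epsilon>" for \<epsilon>
  proof (rule homeomorphic_maps_imp_map)
    have "continuous_map (boundary_topology x\<^sub>0 \<epsilon>) (boundary_topology y\<^sub>0 \<epsilon>) \<phi>"
      by (rule continuous_map_shadow[OF K e]) (use \<phi> in \<open>simp_all add: rel_def\<close>)
    moreover have "continuous_map (boundary_topology y\<^sub>0 \<epsilon>) (boundary_topology x\<^sub>0 \<epsilon>) \<psi>"
      by (rule swap.continuous_map_shadow[OF K e]) (use \<psi> in \<open>simp_all add: rel_def\<close>)
    ultimately show
      "homeomorphic_maps (boundary_topology x\<^sub>0 \<epsilon>) (boundary_topology y\<^sub>0 \<epsilon>) \<phi> \<psi>"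
      unfolding homeomorphic_maps_def topspace_boundary_topology[OF X] topspace_boundary_topology[OF Y]
      using inverse inverse' by blast
  qed
  then show thesis using that[of K \<phi>] K \<phi> unfolding rel_def by blast
qed

text \<open>Membership in \<open>cone_nbhd\<close> at one radius \<open>R\<close> supplies the
  premises of \<open>segments_converge\<close> with \<open>\<delta> = \<epsilon>\<close>, index by
  index, so any filter will do.\<close>

lemma limitin_shadow:
  assumes \<alpha>: "\<alpha> \<in> boundary" and \<beta>: "\<beta> \<in> boundary" and K: "0 \<le> K" and e: "0 < \<epsilon>"
    and sh: "boundary_shadows A u v x\<^sub>0 y\<^sub>0 K \<alpha> \<beta>" and g: "\<And>i. g i \<in> A"
    and lim: "limitin (cone_topology x\<^sub>0 \<epsilon>) (\<lambda>i. Inl (u (g i))) (Inr \<alpha>) F"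
  shows "limitin (cone_topology y\<^sub>0 \<epsilon>) (\<lambda>i. Inl (v (g i))) (Inr \<beta>) F"
  unfolding limitin_cone_topology_iff[OF Y \<beta> e]
proof (intro allI impI)
  fix r :: real assume r: "0 < r"
  obtain \<xi> where \<xi>: "\<xi> \<in> \<alpha>" "\<xi> 0 = x\<^sub>0" "geodesic_ray \<xi>" using boundary_ray_from[OF X \<alpha>] .
  obtain \<eta> where \<eta>: "\<eta> \<in> \<beta>" "\<eta> 0 = y\<^sub>0" "geodesic_ray \<eta>" using boundary_ray_from[OF Y \<beta>] .
  have sh': "shadows A u v K \<xi> \<eta>" using boundary_shadowsD[OF sh \<xi>(1) \<eta>(1) \<xi>(2) \<eta>(2)] .
  obtain R where R: "0 < R"
    "\<And>\<xi> \<eta> g c l e m. \<lbrakk>geodesic_ray \<xi>; geodesic_ray \<eta>; \<xi> 0 = x\<^sub>0; \<eta> 0 = y\<^sub>0; shadows A u v K \<xi> \<eta>;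
       g \<in> A; geodesic_path c l x\<^sub>0 (u g); geodesic_path e m y\<^sub>0 (v g); R \<le> l;
       dist (\<xi> R) (c R) \<le> \<epsilon>\<rbrakk> \<Longrightarrow> r < m \<and> dist (\<eta> r) (e r) < \<epsilon>"
    using segments_converge[OF less_imp_le[OF r] K less_imp_le[OF e] e] by metis
  have "\<forall>\<^sub>F i in F. Inl (u (g i)) \<in> cone_nbhd x\<^sub>0 \<epsilon> \<alpha> R"
    using lim R(1) unfolding limitin_cone_topology_iff[OF X \<alpha> e] by blast
  then show "\<forall>\<^sub>F i in F. Inl (v (g i)) \<in> cone_nbhd y\<^sub>0 \<epsilon> \<beta> r"
  proof (rule eventually_mono)
    fix i assume near: "Inl (u (g i)) \<in> cone_nbhd x\<^sub>0 \<epsilon> \<alpha> R"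
    obtain c where c: "geodesic_path c (dist x\<^sub>0 (u (g i))) x\<^sub>0 (u (g i))"
      using geodesic_path_exists[OF X] .
    obtain d where d: "geodesic_path d (dist y\<^sub>0 (v (g i))) y\<^sub>0 (v (g i))"
      using geodesic_path_exists[OF Y] .
    have "R < dist x\<^sub>0 (u (g i)) \<and> dist (\<xi> R) (c R) < \<epsilon>"
      using near cone_nbhd_Inl_iff[OF X \<alpha> \<xi>(1,2) c] R(1) by simp
    then have "r < dist y\<^sub>0 (v (g i)) \<and> dist (\<eta> r) (d r) < \<epsilon>"
      using R(2)[OF \<xi>(3) \<eta>(3) \<xi>(2) \<eta>(2) sh' g c d] by simp
    then show "Inl (v (g i)) \<in> cone_nbhd y\<^sub>0 \<epsilon> \<beta> r"
      using cone_nbhd_Inl_iff[OF Y \<beta> \<eta>(1,2) d] r by simp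
  qed
qed

end

section \<open>Geometric actions and the theorem\<close>

lemma asymptotic_isometry:
  assumes f: "\<And>x y. dist (f x) (f y) = dist x y" and c: "(c, c') \<in> asymptotic"
  shows "(f \<circ> c, f \<circ> c') \<in> asymptotic"
proof -
  obtain K where "geodesic_ray c" "geodesic_ray c'" "\<And>t. 0 \<le> t \<Longrightarrow> dist (c t) (c' t) \<le> K"
    using asymptoticD[OF c] by blast
  then show ?thesis using f by (intro asymptoticI[of _ _ K]) (auto simp: geodesic_ray_def)
qed

text \<open>The pointwise image is a full class because \<open>f\<close> has an isometric inverse
  \<open>h\<close>: a ray \<open>b\<close> asymptotic to \<open>f \<circ> c\<close> is the image of
  \<open>h \<circ> b\<close>.\<close>

lemma boundary_map_in_boundary:
  assumes f: "\<And>x y. dist (f x) (f y) = dist x y" and surj: "surj f" and \<alpha>: "\<alpha> \<in> boundary"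
  shows "boundary_map f \<alpha> \<in> boundary"
proof -
  obtain c where c: "geodesic_ray c" "\<alpha> = asymptotic `` {c}"
    using \<alpha> unfolding boundary_def by (auto elim!: quotientE)
  have "c \<in> \<alpha>" using c asymptotic_class by blast
  obtain h where h: "\<And>y. f (h y) = y" using surj by (metis surjD)
  have hf: "h (f x) = x" for x using f[of "h (f x)" x] h by simp
  have h_dist: "dist (h x) (h y) = dist x y" for x y using f[of "h x" "h y"] h by simp
  have "boundary_map f \<alpha> = asymptotic `` {f \<circ> c}"
  proof (intro subset_antisym subsetI)
    fix b assume "b \<in> boundary_map f \<alpha>"
    then show "b \<in> asymptotic `` {f \<circ> c}"
      using asymptotic_isometry[OF f] c by (auto simp: boundary_map_def)
  next
    fix b assume "b \<in> asymptotic `` {f \<circ> c}"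
    then have "(h \<circ> (f \<circ> c), h \<circ> b) \<in> asymptotic" using asymptotic_isometry[OF h_dist] by blast
    then have "(c, h \<circ> b) \<in> asymptotic" by (simp add: o_def hf)
    then have "h \<circ> b \<in> \<alpha>" using boundary_closed[OF \<alpha> \<open>c \<in> \<alpha>\<close>] by blast
    moreover have "f \<circ> (h \<circ> b) = b" by (simp add: fun_eq_iff h)
    ultimately show "b \<in> boundary_map f \<alpha>" unfolding boundary_map_def by (metis image_eqI)
  qed
  moreover have "geodesic_ray (f \<circ> c)" using c f by (simp add: geodesic_ray_def)
  ultimately show ?thesis using asymptotic_class by simp
qed

text \<open>Properness is given only locally, with a radius for each point. Finitely many balls of
  these radii cover the compact ball of radius \<open>R\<close>, and each of them receives only
  finitely many orbit points, counted with the group elements.\<close>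

lemma geometric_action_finite_returns:
  assumes act: "geometric_action G \<phi>" and proper: "\<And>(x::'a::metric_space) r. compact (cball x r)"
  shows "finite {g \<in> carrier G. dist x (\<phi> g x :: 'a) \<le> R}"
proof -
  interpret group_action G UNIV \<phi> using act by (simp add: geometric_action_def)
  interpret group G using group_hom by (simp add: group_hom_def)
  have "\<forall>z. \<exists>r>0. finite {g \<in> carrier G. \<phi> g ` cball z r \<inter> cball z r \<noteq> {}}"
    using act by (simp add: geometric_action_def)
  from choice[OF this] obtain \<rho> where
    "\<forall>z. 0 < \<rho> z \<and> finite {g \<in> carrier G. \<phi> g ` cball z (\<rho> z) \<inter> cball z (\<rho> z) \<noteq> {}}"
    by blast
  then have \<rho>: "0 < \<rho> z"
    and fin: "finite {g \<in> carrier G. \<phi> g ` cball z (\<rho> z) \<inter> cball z (\<rho> z) \<noteq> {}}" for z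
    by simp_all
  have locally_finite: "finite {g \<in> carrier G. \<phi> g x \<in> ball z (\<rho> z)}" for z
  proof (cases "\<exists>h\<in>carrier G. \<phi> h x \<in> ball z (\<rho> z)")
    case True
    then obtain h where h: "h \<in> carrier G" "\<phi> h x \<in> ball z (\<rho> z)" by blast
    \<comment> \<open>If \<open>g\<close> and a fixed \<open>h\<close> both bring \<open>x\<close>
      into the ball, then g h^-1 makes the ball meet itself; so \<open>g\<close> lies in a right
      translate of a finite set.\<close>
    have "{g \<in> carrier G. \<phi> g x \<in> ball z (\<rho> z)} \<subseteq>
      (\<lambda>f. f \<otimes>\<^bsub>G\<^esub> h) ` {g \<in> carrier G. \<phi> g ` cball z (\<rho> z) \<inter> cball z (\<rho> z) \<noteq> {}}"
    proof
      fix g assume "g \<in> {g \<in> carrier G. \<phi> g x \<in> ball z (\<rho> z)}"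
      then have g: "g \<in> carrier G" "\<phi> g x \<in> ball z (\<rho> z)" by simp_all
      let ?f = "g \<otimes>\<^bsub>G\<^esub> inv\<^bsub>G\<^esub> h"
      have "\<phi> (inv\<^bsub>G\<^esub> h) (\<phi> h x) = x" using orbit_sym_aux[OF h(1)] by simp
      then have "\<phi> ?f (\<phi> h x) = \<phi> g x" using composition_rule[of "\<phi> h x" g "inv\<^bsub>G\<^esub> h"] g h by simp
      then have "\<phi> g x \<in> \<phi> ?f ` cball z (\<rho> z) \<inter> cball z (\<rho> z)"
        using g h by (auto simp: mem_ball mem_cball intro!: image_eqI[of _ _ "\<phi> h x"])
      moreover have "g = ?f \<otimes>\<^bsub>G\<^esub> h" using g h by (simp add: m_assoc)
      ultimately show "g \<in> (\<lambda>f. f \<otimes>\<^bsub>G\<^esub> h) ` {g \<in> carrier G. \<phi> g ` cball z (\<rho> z) \<inter> cball z (\<rho> z) \<noteq> {}}"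
        using g h by (intro image_eqI[of _ _ ?f]) auto
    qed
    then show ?thesis by (rule finite_subset) (intro finite_imageI fin)
  next
    case False
    then have "{g \<in> carrier G. \<phi> g x \<in> ball z (\<rho> z)} = {}" by blast
    then show ?thesis by (simp only: finite.emptyI)
  qed
  have "cball x R \<subseteq> (\<Union>z\<in>UNIV. ball z (\<rho> z))"
  proof
    fix z
    have "z \<in> ball z (\<rho> z)" using \<rho> by simp
    then show "z \<in> (\<Union>z\<in>UNIV. ball z (\<rho> z))" by blast
  qed
  then obtain Z where Z: "finite Z" "cball x R \<subseteq> (\<Union>z\<in>Z. ball z (\<rho> z))"
    by (rule compactE_image[OF proper open_ball]) blast
  have "{g \<in> carrier G. dist x (\<phi> g x) \<le> R} \<subseteq> (\<Union>z\<in>Z. {g \<in> carrier G. \<phi> g x \<in> ball z (\<rho> z)})"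
  proof
    fix g assume g: "g \<in> {g \<in> carrier G. dist x (\<phi> g x) \<le> R}"
    then have "\<phi> g x \<in> cball x R" by simp
    then obtain z where "z \<in> Z" "\<phi> g x \<in> ball z (\<rho> z)" using Z(2) by blast
    then show "g \<in> (\<Union>z\<in>Z. {g \<in> carrier G. \<phi> g x \<in> ball z (\<rho> z)})" using g by blast
  qed
  moreover have "finite (\<Union>z\<in>Z. {g \<in> carrier G. \<phi> g x \<in> ball z (\<rho> z)})"
    by (intro finite_UN_I Z(1) locally_finite)
  ultimately show ?thesis by (rule finite_subset)
qed

lemma geometric_action_orbit_dist:
  assumes act: "geometric_action G \<phi>" and g: "a \<in> carrier G" "b \<in> carrier G"
  shows "dist (\<phi> a x) (\<phi> b x) = dist x (\<phi> (inv\<^bsub>G\<^esub> a \<otimes>\<^bsub>G\<^esub> b) x)"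
proof -
  interpret group_action G UNIV \<phi> using act by (simp add: geometric_action_def)
  interpret group G using group_hom by (simp add: group_hom_def)
  have "dist (\<phi> a x) (\<phi> b x) = dist (\<phi> (inv\<^bsub>G\<^esub> a) (\<phi> a x)) (\<phi> (inv\<^bsub>G\<^esub> a) (\<phi> b x))"
    using act g by (simp add: geometric_action_def)
  also have "\<phi> (inv\<^bsub>G\<^esub> a) (\<phi> a x) = x" using orbit_sym_aux[OF g(1)] by simp
  also have "\<phi> (inv\<^bsub>G\<^esub> a) (\<phi> b x) = \<phi> (inv\<^bsub>G\<^esub> a \<otimes>\<^bsub>G\<^esub> b) x" using composition_rule g by simp
  finally show ?thesis .
qed

text \<open>Distances in either orbit depend only on a^-1 b. Only finitely many elements displace
  \<open>x\<close> by at most \<open>C\<close>, so their displacements of \<open>y\<close> have a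
  maximum.\<close>

lemma geometric_actions_coarse:
  assumes X: "geometric_action G \<phi>" and Y: "geometric_action G \<psi>"
    and proper: "\<And>(x::'a::metric_space) r. compact (cball x r)"
  shows "coarse_map_on (carrier G) (\<lambda>g. \<phi> g (x::'a)) (\<lambda>g. \<psi> g y)"
  unfolding coarse_map_on_def
proof
  fix C
  interpret group_action G UNIV \<phi> using X by (simp add: geometric_action_def)
  interpret group G using group_hom by (simp add: group_hom_def)
  have "finite ((\<lambda>g. dist y (\<psi> g y)) ` {g \<in> carrier G. dist x (\<phi> g x) \<le> C})"
    using geometric_action_finite_returns[OF X proper] by blast
  then obtain C' where C': "\<And>g. \<lbrakk>g \<in> carrier G; dist x (\<phi> g x) \<le> C\<rbrakk> \<Longrightarrow> dist y (\<psi> g y) \<le> C'"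
    by (auto dest!: bdd_above_finite elim!: bdd_above.E)
  have "dist (\<psi> a y) (\<psi> b y) \<le> C'"
    if "a \<in> carrier G" "b \<in> carrier G" "dist (\<phi> a x) (\<phi> b x) \<le> C" for a b
    using that C'[of "inv\<^bsub>G\<^esub> a \<otimes>\<^bsub>G\<^esub> b"]
      geometric_action_orbit_dist[OF X that(1,2)] geometric_action_orbit_dist[OF Y that(1,2)] by simp
  then show "\<exists>C'. \<forall>a\<in>carrier G. \<forall>b\<in>carrier G. dist (\<phi> a x) (\<phi> b x) \<le> C \<longrightarrow> dist (\<psi> a y) (\<psi> b y) \<le> C'"
    by blast
qed

lemma geometric_action_surj:
  assumes "geometric_action G \<phi>" "g \<in> carrier G"
  shows "surj (\<phi> g)"
  using assms group_action.surj_prop[of G UNIV \<phi> g] by (simp add: geometric_action_def)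

lemma geometric_action_isometry:
  assumes "geometric_action G \<phi>" "g \<in> carrier G"
  shows "dist (\<phi> g x) (\<phi> g y) = dist x y"
  using assms by (simp add: geometric_action_def)

lemma shadows_translate:
  assumes X: "geometric_action G \<phi>" and Y: "geometric_action G \<psi>" and g: "g \<in> carrier G"
    and sh: "shadows (carrier G) (\<lambda>g. \<phi> g x) (\<lambda>g. \<psi> g y) K \<xi> \<eta>"
  shows "shadows (carrier G) (\<lambda>g. \<phi> g x) (\<lambda>g. \<psi> g y) K (\<phi> g \<circ> \<xi>) (\<psi> g \<circ> \<eta>)"
  unfolding shadows_def
proof (intro allI impI)
  interpret X: group_action G UNIV \<phi> using X by (simp add: geometric_action_def)
  interpret Y: group_action G UNIV \<psi> using Y by (simp add: geometric_action_def)
  interpret group G using X.group_hom by (simp add: group_hom_def)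
  fix t :: real assume "0 \<le> t"
  then obtain s a where s: "0 \<le> s" "a \<in> carrier G" "dist (\<phi> a x) (\<xi> t) \<le> K" "dist (\<psi> a y) (\<eta> s) \<le> K"
    using shadowsE[OF sh] by metis
  have "dist (\<phi> (g \<otimes>\<^bsub>G\<^esub> a) x) ((\<phi> g \<circ> \<xi>) t) = dist (\<phi> a x) (\<xi> t)"
    "dist (\<psi> (g \<otimes>\<^bsub>G\<^esub> a) y) ((\<psi> g \<circ> \<eta>) s) = dist (\<psi> a y) (\<eta> s)"
    using X Y g s X.composition_rule Y.composition_rule by (simp_all add: geometric_action_def)
  then show "\<exists>s\<ge>0. \<exists>a\<in>carrier G. dist (\<phi> a x) ((\<phi> g \<circ> \<xi>) t) \<le> K \<and> dist (\<psi> a y) ((\<psi> g \<circ> \<eta>) s) \<le> K"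
    using s g by (metis m_closed)
qed

theorem theorem1p1:
  fixes G :: "('g, 'm) monoid_scheme"
    and act_X :: "'g \<Rightarrow> 'x::metric_space \<Rightarrow> 'x"
    and act_Y :: "'g \<Rightarrow> 'y::metric_space \<Rightarrow> 'y"
    and x\<^sub>0 :: 'x and y\<^sub>0 :: 'y
    and N M \<epsilon> :: real
  assumes "group G"
    and "CAT0_space TYPE('x)" and "CAT0_space TYPE('y)"
    and "geometric_action G act_X" and "geometric_action G act_Y"
    and "N > 0" and "M > 0"
    and "(\<Union>g\<in>carrier G. act_X g ` cball x\<^sub>0 N) = UNIV"
    and "(\<Union>g\<in>carrier G. act_Y g ` cball y\<^sub>0 M) = UNIV"
    and "\<forall>g\<in>carrier G. \<forall>a\<in>carrier G.
           seg x\<^sub>0 (act_X g x\<^sub>0) \<inter> cball (act_X a x\<^sub>0) N \<noteq> {} \<longrightarrow>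
           seg y\<^sub>0 (act_Y g y\<^sub>0) \<inter> cball (act_Y a y\<^sub>0) M \<noteq> {}"
    and "\<epsilon> > 0"
  shows "\<exists>\<phi> :: (real \<Rightarrow> 'x) set \<Rightarrow> (real \<Rightarrow> 'y) set.
           homeomorphic_map (boundary_topology x\<^sub>0 \<epsilon>) (boundary_topology y\<^sub>0 \<epsilon>) \<phi> \<and>
           (\<forall>g\<in>carrier G. \<forall>\<alpha>\<in>boundary.
              \<phi> (boundary_map (act_X g) \<alpha>) = boundary_map (act_Y g) (\<phi> \<alpha>)) \<and>
           (\<forall>\<alpha>\<in>boundary. \<forall>g :: nat \<Rightarrow> 'g. (\<forall>i. g i \<in> carrier G) \<longrightarrow>
              limitin (cone_topology x\<^sub>0 \<epsilon>) (\<lambda>i. Inl (act_X (g i) x\<^sub>0)) (Inr \<alpha>) sequentially \<longrightarrow>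
              limitin (cone_topology y\<^sub>0 \<epsilon>) (\<lambda>i. Inl (act_Y (g i) y\<^sub>0)) (Inr (\<phi> \<alpha>)) sequentially)"
proof -
  let ?u = "\<lambda>g. act_X g x\<^sub>0" and ?v = "\<lambda>g. act_Y g y\<^sub>0"
  note X = assms(2) and Y = assms(3) and act = assms(4,5)
  interpret GX: group_action G UNIV act_X using act by (simp add: geometric_action_def)
  interpret GY: group_action G UNIV act_Y using act by (simp add: geometric_action_def)
  have proper: "compact (cball (x::'x) r)" "compact (cball (y::'y) r)" for x y r
    using X Y by (simp_all add: CAT0_space_def)
  interpret segment_shadows "carrier G" ?u ?v x\<^sub>0 y\<^sub>0 N M
  proof unfold_locales
    show "CAT0_space TYPE('x)" "CAT0_space TYPE('y)" by fact+
    show "coarse_map_on (carrier G) ?u ?v" "coarse_map_on (carrier G) ?v ?u"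
      using geometric_actions_coarse act proper by blast+
    have "act_X \<one>\<^bsub>G\<^esub> x\<^sub>0 = x\<^sub>0" "act_Y \<one>\<^bsub>G\<^esub> y\<^sub>0 = y\<^sub>0"
      using GX.id_eq_one GY.id_eq_one by (metis UNIV_I restrict_apply')+
    then show "\<exists>b\<in>carrier G. ?u b = x\<^sub>0 \<and> ?v b = y\<^sub>0"
      using group.is_monoid[OF assms(1)] monoid.one_closed by blast
    show "0 \<le> N" "0 \<le> M" using assms(6,7) by simp_all
    show "\<exists>a\<in>carrier G. dist (?u a) p \<le> N" for p
    proof -
      have "p \<in> (\<Union>g\<in>carrier G. act_X g ` cball x\<^sub>0 N)" using assms(8) by simp
      then obtain g q where gq: "g \<in> carrier G" "p = act_X g q" "dist x\<^sub>0 q \<le> N"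
        by (auto simp: mem_cball)
      have "dist (?u g) p = dist x\<^sub>0 q" using act(1) gq(1,2) by (simp add: geometric_action_def)
      then show ?thesis using gq(1,3) by (intro bexI[of _ g]) simp_all
    qed
    show "\<exists>a\<in>carrier G. dist (?v a) p \<le> M" for p
    proof -
      have "p \<in> (\<Union>g\<in>carrier G. act_Y g ` cball y\<^sub>0 M)" using assms(9) by simp
      then obtain g q where gq: "g \<in> carrier G" "p = act_Y g q" "dist y\<^sub>0 q \<le> M"
        by (auto simp: mem_cball)
      have "dist (?v g) p = dist y\<^sub>0 q" using act(2) gq(1,2) by (simp add: geometric_action_def)
      then show ?thesis using gq(1,3) by (intro bexI[of _ g]) simp_all
    qed
    show "seg y\<^sub>0 (?v g) \<inter> cball (?v a) M \<noteq> {}"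
      if "g \<in> carrier G" "a \<in> carrier G" "seg x\<^sub>0 (?u g) \<inter> cball (?u a) N \<noteq> {}" for g a
      using assms(10) that by blast
  qed
  obtain K \<phi> where K: "0 \<le> K" and \<phi>: "\<And>\<alpha>. \<alpha> \<in> boundary \<Longrightarrow> \<phi> \<alpha> \<in> boundary"
    and sh: "\<And>\<alpha>. \<alpha> \<in> boundary \<Longrightarrow> boundary_shadows (carrier G) ?u ?v x\<^sub>0 y\<^sub>0 K \<alpha> (\<phi> \<alpha>)"
    and homeo: "\<And>\<epsilon>. 0 < \<epsilon> \<Longrightarrow> homeomorphic_map (boundary_topology x\<^sub>0 \<epsilon>) (boundary_topology y\<^sub>0 \<epsilon>) \<phi>"
    using boundary_homeomorphism by blast
  have equivariant: "\<phi> (boundary_map (act_X g) \<alpha>) = boundary_map (act_Y g) (\<phi> \<alpha>)"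
    if g: "g \<in> carrier G" and \<alpha>: "\<alpha> \<in> boundary" for g \<alpha>
  proof -
    let ?\<alpha> = "boundary_map (act_X g) \<alpha>" and ?\<beta> = "boundary_map (act_Y g) (\<phi> \<alpha>)"
    have \<alpha>': "?\<alpha> \<in> boundary" and \<beta>': "?\<beta> \<in> boundary"
      using boundary_map_in_boundary[OF geometric_action_isometry[OF act(1) g]
          geometric_action_surj[OF act(1) g] \<alpha>]
        boundary_map_in_boundary[OF geometric_action_isometry[OF act(2) g]
          geometric_action_surj[OF act(2) g] \<phi>[OF \<alpha>]] .
    obtain \<xi> where \<xi>: "\<xi> \<in> \<alpha>" "\<xi> 0 = x\<^sub>0" using boundary_ray_from[OF X \<alpha>] .
    obtain \<eta> where \<eta>: "\<eta> \<in> \<phi> \<alpha>" "\<eta> 0 = y\<^sub>0" using boundary_ray_from[OF Y \<phi>[OF \<alpha>]] .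
    obtain \<xi>' where \<xi>': "\<xi>' \<in> ?\<alpha>" "\<xi>' 0 = x\<^sub>0" using boundary_ray_from[OF X \<alpha>'] .
    obtain \<eta>' where \<eta>': "\<eta>' \<in> ?\<beta>" "\<eta>' 0 = y\<^sub>0" using boundary_ray_from[OF Y \<beta>'] .
    \<comment> \<open>These translated rays start at the translated base points; exchanging them for
      \<open>\<xi>'\<close> and \<open>\<eta>'\<close> replaces \<open>K\<close> by some
      \<open>L\<close>, after which uniqueness gives equivariance.\<close>
    have "shadows (carrier G) ?u ?v K (act_X g \<circ> \<xi>) (act_Y g \<circ> \<eta>)"
      using shadows_translate[OF act g] boundary_shadowsD[OF sh[OF \<alpha>] \<xi>(1) \<eta>(1) \<xi>(2) \<eta>(2)] by blast
    moreover have "act_X g \<circ> \<xi> \<in> ?\<alpha>" "act_Y g \<circ> \<eta> \<in> ?\<beta>"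
      using \<xi> \<eta> by (simp_all add: boundary_map_def)
    ultimately obtain L where "shadows (carrier G) ?u ?v L \<xi>' \<eta>'"
      using shadows_asymptotic boundary_asymptotic[OF \<alpha>' _ \<xi>'(1)] boundary_asymptotic[OF \<beta>' _ \<eta>'(1)]
      by metis
    then have "boundary_shadows (carrier G) ?u ?v x\<^sub>0 y\<^sub>0 L ?\<alpha> ?\<beta>"
      using boundary_shadowsI[OF \<alpha>' \<xi>' \<beta>' \<eta>'] by blast
    then show ?thesis using boundary_shadows_unique[OF \<alpha>' \<phi>[OF \<alpha>'] \<beta>' sh[OF \<alpha>']] by blast
  qed
  have "limitin (cone_topology y\<^sub>0 \<epsilon>) (\<lambda>i. Inl (?v (g i))) (Inr (\<phi> \<alpha>)) sequentially"
    if "\<alpha> \<in> boundary" "\<forall>i. g i \<in> carrier G"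
      "limitin (cone_topology x\<^sub>0 \<epsilon>) (\<lambda>i. Inl (?u (g i))) (Inr \<alpha>) sequentially" for \<alpha> and g :: "nat \<Rightarrow> 'g"
    using limitin_shadow[OF that(1) \<phi>[OF that(1)] K assms(11) sh[OF that(1)] _ that(3)] that(2) by blast
  then show ?thesis using homeo[OF assms(11)] equivariant by blast
qed

end
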